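(* Let $a\in L^1(I)$ and $\lambda\in\mathbb{R}$. If $L[\lambda]$ is nonresonant in $X_P$ and in $X_{M_1}$, then for all $(t,s)\in I\times I$ $$G_{M_1}[\lambda](t,s)=G_P[\lambda](t,s)+r_3[\lambda](t)\,G_{M_1}[\lambda](0,s)-r_4[\lambda](t)\,\frac{\partial}{\partial t}G_{M_1}[\lambda](1,s)$$ $$=G_P[\lambda](t,s)-\frac{\partial}{\partial s}G_P[\lambda](t,0)\,G_{M_1}[\lambda](0,s)-G_P[\lambda](t,0)\,\frac{\partial}{\partial t}G_{M_1}[\lambda](1,s).$$
   Context: $I=[0,1]$, $a\in L^1(I)$ is real-valued, $\lambda\in\mathbb{R}$, and $L[\lambda]u(t)=u''(t)+(a(t)+\lambda)u(t)$. $W^{2,1}(I)=\{u\in C(I):u'\in AC(I)\}$, where $AC(I)$ is the set of absolutely continuous functions on $I$. $X_P=\{u\in W^{2,1}(I):u(0)=u(1),\,u'(0)=u'(1)\}$ (periodic) and $X_{M_1}=\{u\in W^{2,1}(I):u'(0)=u(1)=0\}$ (Mixed 1). $L[\lambda]$ is nonresonant in $X$ if $u=0$ is the only $u\in X$ with $L[\lambda]u=0$ a.e. on $I$. In that case, for every $\sigma\in L^1(I)$ the problem $L[\lambda]u=\sigma$ a.e. on $I$, $u\in X$, has a unique solution, given by $u(t)=\int_0^1G(t,s)\sigma(s)\,ds$, where the continuous function $G:I\times I\to\mathbb{R}$ is the Green's function; it is denoted $G_P[\lambda]$ for $X=X_P$ and $G_{M_1}[\lambda]$ for $X=X_{M_1}$.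 $r_3[\lambda]$ is the unique solution of $L[\lambda]u=0$ a.e. on $I$, $u(0)-u(1)=1$, $u'(0)-u'(1)=0$; $r_4[\lambda]$ is the unique solution of $L[\lambda]u=0$ a.e. on $I$, $u(0)-u(1)=0$, $u'(0)-u'(1)=1$. Convention: $\frac{\partial}{\partial s}G(t,0)$ is the (one-sided) derivative in the second variable for $t\in(0,1)$, extended by continuity to $t\in\{0,1\}$; $\frac{\partial}{\partial t}G(1,s)$ is the one-sided derivative in the first variable at $t=1$ for $s\in(0,1)$, extended by continuity to $s\in\{0,1\}$. *)

theory Defs
  imports "HOL-Analysis.Analysis"
begin

text \<open>Functions on the unit interval are total functions on the reals; every notion below depends only
  on their values on \<open>{0..1}\<close>.\<close>

text \<open>Absolute continuity on \<open>S\<close> in the epsilon-delta sense. A division of a subset of \<open>S\<close> is a finite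
  family of closed intervals \<open>K = {Inf K..Sup K}\<close> with pairwise disjoint interiors.\<close>

definition abs_continuous_on :: "real set \<Rightarrow> (real \<Rightarrow> real) \<Rightarrow> bool" where
  "abs_continuous_on S f \<longleftrightarrow>
     (\<forall>\<epsilon>>0. \<exists>\<delta>>0. \<forall>D T. D division_of T \<and> T \<subseteq> S \<and> (\<Sum>K\<in>D. Sup K - Inf K) < \<delta> \<longrightarrow>
        (\<Sum>K\<in>D. \<bar>f (Sup K) - f (Inf K)\<bar>) < \<epsilon>)"

text \<open>The derivative relative to \<open>{0..1}\<close>, hence one-sided at \<open>0\<close> and \<open>1\<close>.\<close>

definition dI :: "(real \<Rightarrow> real) \<Rightarrow> real \<Rightarrow> real" where
  "dI u t = vector_derivative u (at t within {0..1})"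

definition W21 :: "(real \<Rightarrow> real) set" where
  "W21 = {u. continuous_on {0..1} u \<and> (\<forall>t\<in>{0..1}. u differentiable (at t within {0..1})) \<and>
             abs_continuous_on {0..1} (dI u)}"

definition X_P :: "(real \<Rightarrow> real) set" where
  "X_P = {u \<in> W21. u 0 = u 1 \<and> dI u 0 = dI u 1}"

definition X_M1 :: "(real \<Rightarrow> real) set" where
  "X_M1 = {u \<in> W21. dI u 0 = 0 \<and> u 1 = 0}"

definition L_op :: "(real \<Rightarrow> real) \<Rightarrow> real \<Rightarrow> (real \<Rightarrow> real) \<Rightarrow> real \<Rightarrow> real" where
  "L_op a lam u t = dI (dI u) t + (a t + lam) * u t"

text \<open>The equation \<open>L[\<lambda>]u = \<sigma>\<close> a.e. on \<open>{0..1}\<close>. Since \<open>vector_derivative\<close> is arbitrary where no derivative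
  exists, the existence of the second derivative almost everywhere is spelled out.\<close>

definition solves_ae ::
  "(real \<Rightarrow> real) \<Rightarrow> real \<Rightarrow> (real \<Rightarrow> real) \<Rightarrow> (real \<Rightarrow> real) \<Rightarrow> bool" where
  "solves_ae a lam \<sigma> u \<longleftrightarrow>
     (AE t in lebesgue_on {0..1}. dI u differentiable (at t within {0..1}) \<and> L_op a lam u t = \<sigma> t)"

definition nonresonant :: "(real \<Rightarrow> real) set \<Rightarrow> (real \<Rightarrow> real) \<Rightarrow> real \<Rightarrow> bool" where
  "nonresonant X a lam \<longleftrightarrow> (\<forall>u\<in>X. solves_ae a lam (\<lambda>_. 0) u \<longrightarrow> (\<forall>t\<in>{0..1}. u t = 0))"

text \<open>\<open>G\<close> is a Green's function if it is continuous and, for every integrable \<open>\<sigma>\<close>, the solutions of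
  \<open>L[\<lambda>]u = \<sigma>\<close> in \<open>X\<close> are exactly the functions agreeing with \<open>\<integral> G(t,s) \<sigma>(s) ds\<close> on \<open>{0..1}\<close>.\<close>

definition is_green ::
  "(real \<Rightarrow> real) set \<Rightarrow> (real \<Rightarrow> real) \<Rightarrow> real \<Rightarrow> (real \<Rightarrow> real \<Rightarrow> real) \<Rightarrow> bool" where
  "is_green X a lam G \<longleftrightarrow>
     continuous_on ({0..1} \<times> {0..1}) (\<lambda>(t, s). G t s) \<and>
     (\<forall>\<sigma>. \<sigma> absolutely_integrable_on {0..1} \<longrightarrow>
        (\<forall>u. u \<in> X \<and> solves_ae a lam \<sigma> u \<longleftrightarrow>
             (\<forall>t\<in>{0..1}. u t = (LINT s:{0..1}|lebesgue. G t s * \<sigma> s))))"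

text \<open>\<open>SOME\<close> rather than \<open>THE\<close>: the objects below are unique on \<open>{0..1}\<close>, but arbitrary outside it.\<close>

definition green :: "(real \<Rightarrow> real) set \<Rightarrow> (real \<Rightarrow> real) \<Rightarrow> real \<Rightarrow> real \<Rightarrow> real \<Rightarrow> real" where
  "green X a lam = (SOME G. is_green X a lam G)"

definition G_P :: "(real \<Rightarrow> real) \<Rightarrow> real \<Rightarrow> real \<Rightarrow> real \<Rightarrow> real" where
  "G_P a lam = green X_P a lam"

definition G_M1 :: "(real \<Rightarrow> real) \<Rightarrow> real \<Rightarrow> real \<Rightarrow> real \<Rightarrow> real" where
  "G_M1 a lam = green X_M1 a lam"

definition r3 :: "(real \<Rightarrow> real) \<Rightarrow> real \<Rightarrow> real \<Rightarrow> real" where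
  "r3 a lam = (SOME u. u \<in> W21 \<and> solves_ae a lam (\<lambda>_. 0) u \<and> u 0 - u 1 = 1 \<and> dI u 0 - dI u 1 = 0)"

definition r4 :: "(real \<Rightarrow> real) \<Rightarrow> real \<Rightarrow> real \<Rightarrow> real" where
  "r4 a lam = (SOME u. u \<in> W21 \<and> solves_ae a lam (\<lambda>_. 0) u \<and> u 0 - u 1 = 0 \<and> dI u 0 - dI u 1 = 1)"

text \<open>Extension by continuity from the open interval to its endpoints.\<close>

definition ext_cont :: "(real \<Rightarrow> real) \<Rightarrow> real \<Rightarrow> real" where
  "ext_cont f x = (if x \<in> {0<..<1} then f x else Lim (at x within {0<..<1}) f)"

definition ds_at_0 :: "(real \<Rightarrow> real \<Rightarrow> real) \<Rightarrow> real \<Rightarrow> real" where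
  "ds_at_0 G = ext_cont (\<lambda>t. dI (\<lambda>s. G t s) 0)"

definition dt_at_1 :: "(real \<Rightarrow> real \<Rightarrow> real) \<Rightarrow> real \<Rightarrow> real" where
  "dt_at_1 G = ext_cont (\<lambda>s. dI (\<lambda>t. G t s) 1)"

end

theory Submission
  imports Defs
begin

text \<open>Fix the fundamental system \<open>\<phi>\<close>, \<open>\<psi>\<close> of \<open>u'' + (a + \<lambda>) u = 0\<close> with \<open>\<phi>(0) = 1\<close>, \<open>\<phi>'(0) = 0\<close>,
  \<open>\<psi>(0) = 0\<close>, \<open>\<psi>'(0) = 1\<close>, and let \<open>k(t,s) = \<psi>(t) \<phi>(s) - \<phi>(t) \<psi>(s)\<close>. Because the Wronskian is \<open>1\<close>, variation
  of constants shows that \<open>p(t) = \<integral>\<^sub>0\<^sup>t k(t,s) \<sigma>(s) ds\<close> solves the inhomogeneous equation with zero initial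
  data (\<open>variation_of_constants\<close>). Adding homogeneous solutions so as to restore the boundary conditions
  gives Green's functions of the form
  \<open>[s \<le> t] k(t,s) + \<omega>(t) k(1,s) + \<eta>(t) \<partial>\<^sub>t k(1,s)\<close>
  (\<open>is_green_green_kernel\<close>). For the mixed problem \<open>\<omega> = - \<phi> / \<phi>(1)\<close> and \<open>\<eta> = 0\<close>; for the periodic problem
  \<open>\<omega> = r3\<close> and \<open>\<eta> = r4\<close>, since the particular solution has the jumps \<open>-p(1)\<close> and \<open>-p'(1)\<close> and \<open>r3\<close>, \<open>r4\<close>
  are the homogeneous solutions with unit jumps.

  The two kernels therefore differ only in their correction terms. Everything else is one observation:
  by nonresonance in \<open>X_P\<close>, a homogeneous solution equals its jump in value times \<open>r3\<close> plus its jump in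
  slope times \<open>r4\<close> (\<open>jump_expansion\<close>). For \<open>\<phi>\<close> this yields the first equality, and also
  \<open>\<partial>\<^sub>s G_P(t,0) = - r3(t)\<close>; for \<open>\<psi>\<close> it yields \<open>G_P(t,0) = r4(t)\<close>. These two values give the second
  equality.

  Since \<open>a\<close> is only integrable, the argument rests on Lebesgue's theory of the derivative: the fundamental
  theorem for absolutely continuous functions (\<open>abs_continuous_on_has_integral_derivative\<close>), the
  differentiation of indefinite integrals almost everywhere (\<open>AE_has_derivative_indefinite_integral\<close>), and
  the existence of \<open>\<phi>\<close> and \<open>\<psi>\<close> by a contraction in a weighted norm (\<open>ode_solution_exists\<close>). Uniqueness
  of solutions comes directly from nonresonance.\<close>

section \<open>Absolutely continuous functions\<close>

lemma AE_lebesgue_on_iff_negligible: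
  fixes a b :: real
  shows "(AE t in lebesgue_on {a..b}. P t) \<longleftrightarrow> (\<exists>N. negligible N \<and> (\<forall>t\<in>{a..b} - N. P t))"
proof -
  have "(AE t in lebesgue_on {a..b}. P t) \<longleftrightarrow> (AE t in lebesgue. t \<in> {a..b} \<longrightarrow> P t)"
    by (rule AE_restrict_space_iff) auto
  also have "\<dots> \<longleftrightarrow> (\<exists>N. negligible N \<and> {t. \<not> (t \<in> {a..b} \<longrightarrow> P t)} \<subseteq> N)"
    by (rule eventually_ae_filter_negligible)
  also have "\<dots> \<longleftrightarrow> (\<exists>N. negligible N \<and> (\<forall>t\<in>{a..b} - N. P t))"
    by (intro ex_cong1) blast
  finally show ?thesis .
qed

lemma division_of_real_interval:
  fixes T :: "real set"
  assumes "D division_of T" and "K \<in> D"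
  shows "K = {Inf K..Sup K}" and "Inf K \<le> Sup K" and "Inf K \<in> T" and "Sup K \<in> T"
proof -
  obtain x y where K: "K = {x..y}"
    using division_ofD(4)[OF assms] by auto
  have "K \<noteq> {}" "K \<subseteq> T" using division_ofD(2,3)[OF assms] by auto
  then have "x \<le> y" "x \<in> T" "y \<in> T" by (auto simp: K)
  then show "K = {Inf K..Sup K}" "Inf K \<le> Sup K" "Inf K \<in> T" "Sup K \<in> T"
    by (simp_all add: K)
qed

lemma abs_continuous_on_subset:
  assumes "abs_continuous_on S f" and "S' \<subseteq> S"
  shows "abs_continuous_on S' f"
  unfolding abs_continuous_on_def
proof (intro allI impI)
  fix \<epsilon> :: real assume "\<epsilon> > 0"
  then obtain d where "d > 0" "\<And>D T. D division_of T \<Longrightarrow> T \<subseteq> S \<Longrightarrow> (\<Sum>K\<in>D. Sup K - Inf K) < d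
      \<Longrightarrow> (\<Sum>K\<in>D. \<bar>f (Sup K) - f (Inf K)\<bar>) < \<epsilon>"
    using assms(1) unfolding abs_continuous_on_def by meson
  then show "\<exists>\<delta>>0. \<forall>D T. D division_of T \<and> T \<subseteq> S' \<and> (\<Sum>K\<in>D. Sup K - Inf K) < \<delta> \<longrightarrow>
        (\<Sum>K\<in>D. \<bar>f (Sup K) - f (Inf K)\<bar>) < \<epsilon>"
    using assms(2) by (intro exI[of _ d]) auto
qed

text \<open>Every closure property needed below has one source: the increments of the new function are bounded by
those of two absolutely continuous ones. Sums, products, Lipschitz functions and functions that agree
on \<open>S\<close> with an absolutely continuous one are instances.\<close>

lemma abs_continuous_on_dominated:
  assumes f: "abs_continuous_on S f" and g: "abs_continuous_on S g"
    and h: "\<And>x y. x \<in> S \<Longrightarrow> y \<in> S \<Longrightarrow> \<bar>h y - h x\<bar> \<le> C * (\<bar>f y - f x\<bar> + \<bar>g y - g x\<bar>)"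
  shows "abs_continuous_on S h"
  unfolding abs_continuous_on_def
proof (intro allI impI)
  fix \<epsilon> :: real assume "\<epsilon> > 0"
  \<comment> \<open>Enlarging \<open>C\<close> makes the constant positive, so that dividing by it is harmless.\<close>
  define C' where "C' = max C 1"
  have C': "C' > 0" "C \<le> C'" by (auto simp: C'_def)
  define \<eta> where "\<eta> = \<epsilon> / (2 * C')"
  have "\<eta> > 0" using \<open>\<epsilon> > 0\<close> C' by (simp add: \<eta>_def)
  obtain d1 where d1: "d1 > 0" "\<And>D T. D division_of T \<Longrightarrow> T \<subseteq> S \<Longrightarrow> (\<Sum>K\<in>D. Sup K - Inf K) < d1
      \<Longrightarrow> (\<Sum>K\<in>D. \<bar>f (Sup K) - f (Inf K)\<bar>) < \<eta>"
    using f \<open>\<eta> > 0\<close> unfolding abs_continuous_on_def by meson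
  obtain d2 where d2: "d2 > 0" "\<And>D T. D division_of T \<Longrightarrow> T \<subseteq> S \<Longrightarrow> (\<Sum>K\<in>D. Sup K - Inf K) < d2
      \<Longrightarrow> (\<Sum>K\<in>D. \<bar>g (Sup K) - g (Inf K)\<bar>) < \<eta>"
    using g \<open>\<eta> > 0\<close> unfolding abs_continuous_on_def by meson
  show "\<exists>\<delta>>0. \<forall>D T. D division_of T \<and> T \<subseteq> S \<and> (\<Sum>K\<in>D. Sup K - Inf K) < \<delta> \<longrightarrow>
        (\<Sum>K\<in>D. \<bar>h (Sup K) - h (Inf K)\<bar>) < \<epsilon>"
  proof (intro exI[of _ "min d1 d2"] conjI allI impI)
    show "0 < min d1 d2" using d1 d2 by simp
    fix D T assume A: "D division_of T \<and> T \<subseteq> S \<and> (\<Sum>K\<in>D. Sup K - Inf K) < min d1 d2"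
    have "(\<Sum>K\<in>D. \<bar>h (Sup K) - h (Inf K)\<bar>)
        \<le> (\<Sum>K\<in>D. C' * (\<bar>f (Sup K) - f (Inf K)\<bar> + \<bar>g (Sup K) - g (Inf K)\<bar>))"
    proof (rule sum_mono)
      fix K assume "K \<in> D"
      then have "Inf K \<in> S" "Sup K \<in> S"
        using division_of_real_interval(3,4)[of D T K] A by auto
      then have "\<bar>h (Sup K) - h (Inf K)\<bar> \<le> C * (\<bar>f (Sup K) - f (Inf K)\<bar> + \<bar>g (Sup K) - g (Inf K)\<bar>)"
        by (rule h)
      also have "\<dots> \<le> C' * (\<bar>f (Sup K) - f (Inf K)\<bar> + \<bar>g (Sup K) - g (Inf K)\<bar>)"
        using C' by (intro mult_right_mono) auto
      finally show "\<bar>h (Sup K) - h (Inf K)\<bar> \<le> C' * (\<bar>f (Sup K) - f (Inf K)\<bar> + \<bar>g (Sup K) - g (Inf K)\<bar>)" .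
    qed
    also have "\<dots> = C' * ((\<Sum>K\<in>D. \<bar>f (Sup K) - f (Inf K)\<bar>) + (\<Sum>K\<in>D. \<bar>g (Sup K) - g (Inf K)\<bar>))"
      by (simp flip: sum_distrib_left add: sum.distrib)
    also have "\<dots> < C' * (\<eta> + \<eta>)"
      using A d1(2)[of D T] d2(2)[of D T] C' by (intro mult_strict_left_mono add_strict_mono) auto
    also have "\<dots> = \<epsilon>" using C' by (simp add: \<eta>_def)
    finally show "(\<Sum>K\<in>D. \<bar>h (Sup K) - h (Inf K)\<bar>) < \<epsilon>" .
  qed
qed

lemma abs_continuous_on_imp_continuous_on:
  assumes "abs_continuous_on {a..b} f"
  shows "continuous_on {a..b} f"
  unfolding continuous_on_iff
proof (intro ballI allI impI)
  fix x \<epsilon> :: real assume x: "x \<in> {a..b}" and "\<epsilon> > 0"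
  obtain d where d: "d > 0" "\<And>D T. D division_of T \<Longrightarrow> T \<subseteq> {a..b} \<Longrightarrow> (\<Sum>K\<in>D. Sup K - Inf K) < d
      \<Longrightarrow> (\<Sum>K\<in>D. \<bar>f (Sup K) - f (Inf K)\<bar>) < \<epsilon>"
    using assms \<open>\<epsilon> > 0\<close> unfolding abs_continuous_on_def by meson
  have main: "\<bar>f v - f u\<bar> < \<epsilon>" if "u \<le> v" "v - u < d" "u \<in> {a..b}" "v \<in> {a..b}" for u v
  proof -
    have "{{u..v}} division_of {u..v}"
      using that(1) by (metis atLeastatMost_empty_iff box_real(2) division_of_self)
    moreover have "{u..v} \<subseteq> {a..b}" using that by auto
    ultimately show ?thesis using d(2)[of "{{u..v}}" "{u..v}"] that by auto
  qed
  show "\<exists>d>0. \<forall>x'\<in>{a..b}. dist x' x < d \<longrightarrow> dist (f x') (f x) < \<epsilon>"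
  proof (intro exI[of _ d] conjI ballI impI)
    fix y assume y: "y \<in> {a..b}" "dist y x < d"
    show "dist (f y) (f x) < \<epsilon>"
    proof (cases "x \<le> y")
      case True then show ?thesis using main[of x y] x y by (auto simp: dist_real_def)
    next
      case False then show ?thesis using main[of y x] x y by (auto simp: dist_real_def abs_minus_commute)
    qed
  qed (use d in auto)
qed

lemma abs_continuous_on_id: "abs_continuous_on S (\<lambda>x. x)"
  unfolding abs_continuous_on_def
proof (intro allI impI)
  fix \<epsilon> :: real assume "\<epsilon> > 0"
  show "\<exists>\<delta>>0. \<forall>D T. D division_of T \<and> T \<subseteq> S \<and> (\<Sum>K\<in>D. Sup K - Inf K) < \<delta> \<longrightarrow>
        (\<Sum>K\<in>D. \<bar>Sup K - Inf K\<bar>) < \<epsilon>"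
  proof (intro exI[of _ \<epsilon>] conjI allI impI)
    fix D T assume A: "D division_of T \<and> T \<subseteq> S \<and> (\<Sum>K\<in>D. Sup K - Inf K) < \<epsilon>"
    have "(\<Sum>K\<in>D. \<bar>Sup K - Inf K\<bar>) = (\<Sum>K\<in>D. Sup K - Inf K)"
      using A by (intro sum.cong refl abs_of_nonneg) (simp add: division_of_real_interval(2)[of D T])
    then show "(\<Sum>K\<in>D. \<bar>Sup K - Inf K\<bar>) < \<epsilon>" using A by simp
  qed (fact \<open>\<epsilon> > 0\<close>)
qed

lemma abs_continuous_on_lipschitz:
  assumes "\<And>x y. x \<in> S \<Longrightarrow> y \<in> S \<Longrightarrow> \<bar>h y - h x\<bar> \<le> C * \<bar>y - x\<bar>"
  shows "abs_continuous_on S h"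
proof (rule abs_continuous_on_dominated[OF abs_continuous_on_id abs_continuous_on_id, where C = "C/2"])
  fix x y assume "x \<in> S" "y \<in> S"
  then show "\<bar>h y - h x\<bar> \<le> C / 2 * (\<bar>y - x\<bar> + \<bar>y - x\<bar>)" using assms[of x y] by simp
qed

lemma abs_continuous_on_add:
  "abs_continuous_on S f \<Longrightarrow> abs_continuous_on S g \<Longrightarrow> abs_continuous_on S (\<lambda>x. f x + g x)"
  by (rule abs_continuous_on_dominated[where f = f and g = g and C = 1]) auto

lemma abs_continuous_on_diff:
  "abs_continuous_on S f \<Longrightarrow> abs_continuous_on S g \<Longrightarrow> abs_continuous_on S (\<lambda>x. f x - g x)"
  by (rule abs_continuous_on_dominated[where f = f and g = g and C = 1]) auto

lemma abs_continuous_on_const: "abs_continuous_on S (\<lambda>x. c)"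
  by (rule abs_continuous_on_lipschitz[where C = 0]) auto

lemma continuous_on_interval_bound:
  fixes f :: "real \<Rightarrow> real"
  assumes "continuous_on {a..b} f"
  obtains M where "M \<ge> 0" "\<And>x. x \<in> {a..b} \<Longrightarrow> \<bar>f x\<bar> \<le> M"
proof -
  have "bounded (f ` {a..b})"
    using assms compact_continuous_image compact_imp_bounded by blast
  then obtain M where "M > 0" "\<forall>y\<in>f ` {a..b}. norm y \<le> M"
    unfolding bounded_pos by auto
  then show thesis by (intro that[of M]) auto
qed

lemma abs_continuous_on_mult:
  assumes f: "abs_continuous_on {a..b} f" and g: "abs_continuous_on {a..b} g"
  shows "abs_continuous_on {a..b} (\<lambda>x. f x * g x)"
proof -
  obtain M where M: "M \<ge> 0" "\<And>x. x \<in> {a..b} \<Longrightarrow> \<bar>f x\<bar> \<le> M"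
    using abs_continuous_on_imp_continuous_on[OF f] continuous_on_interval_bound by blast
  obtain N where N: "N \<ge> 0" "\<And>x. x \<in> {a..b} \<Longrightarrow> \<bar>g x\<bar> \<le> N"
    using abs_continuous_on_imp_continuous_on[OF g] continuous_on_interval_bound by blast
  show ?thesis
  proof (rule abs_continuous_on_dominated[OF f g, where C = "M + N"])
    fix x y assume x: "x \<in> {a..b}" and y: "y \<in> {a..b}"
    have "f y * g y - f x * g x = f y * (g y - g x) + g x * (f y - f x)" by algebra
    also have "\<bar>\<dots>\<bar> \<le> \<bar>f y\<bar> * \<bar>g y - g x\<bar> + \<bar>g x\<bar> * \<bar>f y - f x\<bar>"
      by (metis abs_mult abs_triangle_ineq)
    also have "\<dots> \<le> (M + N) * \<bar>g y - g x\<bar> + (M + N) * \<bar>f y - f x\<bar>"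
      using M(1) N(1) M(2)[OF y] N(2)[OF x] by (intro add_mono mult_right_mono) auto
    finally show "\<bar>f y * g y - f x * g x\<bar> \<le> (M + N) * (\<bar>f y - f x\<bar> + \<bar>g y - g x\<bar>)"
      by (simp add: algebra_simps)
  qed
qed

lemma sum_length_division_eq_measure:
  fixes T :: "real set"
  assumes "D division_of T"
  shows "(\<Sum>K\<in>D. Sup K - Inf K) = measure lebesgue T"
proof -
  have T: "T \<in> lmeasurable"
    by (rule lmeasurable_division[OF assms])
  have "measure lebesgue T = integral T (\<lambda>x. 1)"
    using T lmeasure_integral by blast
  also have "\<dots> = (\<Sum>K\<in>D. integral K (\<lambda>x. 1))"
    using assms T by (intro integral_combine_division_topdown) (auto simp: integrable_on_const)
  also have "\<dots> = (\<Sum>K\<in>D. Sup K - Inf K)"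
  proof (rule sum.cong[OF refl])
    fix K assume "K \<in> D"
    note K = division_of_real_interval[OF assms this]
    show "integral K (\<lambda>x. 1) = Sup K - Inf K"
      by (subst K(1)) (use K(2) in simp)
  qed
  finally show ?thesis by simp
qed

text \<open>The fundamental theorem of calculus for absolutely continuous functions, proved directly with gauges.
At points where the derivative exists, the gauge makes the increment of \<open>f\<close> over a tagged
interval close to \<open>g x\<close> times its length. At the remaining points, which form a null set, the gauge
forces the intervals into an open set of small measure, and there absolute continuity makes the total
increment of \<open>f\<close> small. Integrability of \<open>g\<close> is part of the conclusion.\<close>

theorem abs_continuous_on_has_integral_derivative:
  fixes f g :: "real \<Rightarrow> real"
  assumes "a \<le> b" and f: "abs_continuous_on {a..b} f"
    and deriv: "AE x in lebesgue_on {a..b}. (f has_real_derivative g x) (at x within {a..b})"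
  shows "(g has_integral f b - f a) {a..b}"
proof -
  obtain N where N: "negligible N"
    and der: "\<And>x. x \<in> {a..b} - N \<Longrightarrow> (f has_real_derivative g x) (at x within {a..b})"
    using deriv unfolding AE_lebesgue_on_iff_negligible by metis
  \<comment> \<open>On \<open>N\<close> the values of \<open>g\<close> are uncontrolled; they do not affect the integral.\<close>
  define h where "h x = (if x \<in> N then 0 else g x)" for x
  have "(h has_integral f b - f a) (cbox a b)"
    unfolding has_integral
  proof (intro allI impI)
    fix e :: real assume "e > 0"
    define \<eta> where "\<eta> = e / (2 * (b - a + 1))"
    have \<eta>: "\<eta> > 0" "\<eta> * (b - a) < e / 2"
      using \<open>e > 0\<close> \<open>a \<le> b\<close> by (auto simp: \<eta>_def field_simps)
    obtain \<delta> where \<delta>: "\<delta> > 0" "\<And>D T. D division_of T \<Longrightarrow> T \<subseteq> {a..b} \<Longrightarrow> (\<Sum>K\<in>D. Sup K - Inf K) < \<delta>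
        \<Longrightarrow> (\<Sum>K\<in>D. \<bar>f (Sup K) - f (Inf K)\<bar>) < e / 2"
      using f \<open>e > 0\<close> unfolding abs_continuous_on_def by (meson half_gt_zero)
    obtain U where U: "open U" "N \<subseteq> U" "U \<in> lmeasurable" "measure lebesgue U < \<delta>"
    proof -
      have Nnull: "N \<in> null_sets lebesgue" using N negligible_iff_null_sets by blast
      then have "N \<in> sets lebesgue" by auto
      from sets_lebesgue_outer_open[OF this \<open>\<delta> > 0\<close>] obtain U where
        U: "open U" "N \<subseteq> U" "U - N \<in> lmeasurable" "emeasure lebesgue (U - N) < ennreal \<delta>" by metis
      have "U = (U - N) \<union> N" using U by blast
      moreover have "N \<in> lmeasurable" using N negligible_imp_measurable by blast
      ultimately have "U \<in> lmeasurable" using U(3) by (metis fmeasurable.Un)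
      moreover have "measure lebesgue U = measure lebesgue (U - N)"
        by (simp add: Nnull \<open>U \<in> lmeasurable\<close> fmeasurableD measure_Diff_null_set)
      moreover have "measure lebesgue (U - N) < \<delta>"
        using U(3,4) by (metis \<open>\<delta> > 0\<close> emeasure_eq_measure2 ennreal_less_iff measure_nonneg)
      ultimately show thesis using that U by metis
    qed
    have "\<exists>d>0. \<forall>y\<in>{a..b}. \<bar>y - x\<bar> < d \<longrightarrow> \<bar>f y - f x - g x * (y - x)\<bar> \<le> \<eta> * \<bar>y - x\<bar>"
      if "x \<in> {a..b} - N" for x
      using der[OF that] \<open>\<eta> > 0\<close> unfolding has_field_derivative_def has_derivative_within_alt by auto
    then obtain d where d: "\<And>x. x \<in> {a..b} - N \<Longrightarrow> d x > 0"
      "\<And>x y. x \<in> {a..b} - N \<Longrightarrow> y \<in> {a..b} \<Longrightarrow> \<bar>y - x\<bar> < d x \<Longrightarrow>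
         \<bar>f y - f x - g x * (y - x)\<bar> \<le> \<eta> * \<bar>y - x\<bar>"
      by metis
    define \<gamma> where "\<gamma> x = (if x \<in> N then U else if x \<in> {a..b} then ball x (d x) else UNIV)" for x
    have gauge: "gauge \<gamma>"
      unfolding gauge_def \<gamma>_def using U d by auto
    have close: "norm ((\<Sum>(x, K)\<in>p. measure lborel K *\<^sub>R h x) - (f b - f a)) < e"
      if p: "p tagged_division_of cbox a b" "\<gamma> fine p" for p
    proof -
      note ptag = tagged_division_ofD[OF p(1)]
      have p': "p tagged_division_of {a..b}" using p(1) by simp
      have "finite p" by (rule ptag)
      have K: "Inf K \<le> x \<and> x \<le> Sup K \<and> a \<le> Inf K \<and> Sup K \<le> b \<and> measure lborel K = Sup K - Inf K
               \<and> {Inf K..Sup K} \<subseteq> \<gamma> x" and Keq: "{Inf K..Sup K} = K"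
        if "(x, K) \<in> p" for x K
      proof -
        have "K \<in> snd ` p" using that by force
        note D = division_of_real_interval[OF division_of_tagged_division[OF p'] this]
        have "x \<in> K" using ptag(2) that by blast
        then have "x \<in> {Inf K..Sup K}" unfolding D(1)[symmetric] .
        moreover have "measure lborel K = Sup K - Inf K" by (subst D(1)) (use D(2) in simp)
        moreover have "K \<subseteq> \<gamma> x" using p(2) that unfolding fine_def by blast
        then have "{Inf K..Sup K} \<subseteq> \<gamma> x" unfolding D(1)[symmetric] .
        ultimately show "Inf K \<le> x \<and> x \<le> Sup K \<and> a \<le> Inf K \<and> Sup K \<le> b \<and> measure lborel K = Sup K - Inf K
               \<and> {Inf K..Sup K} \<subseteq> \<gamma> x" using D(3,4) by simp
        show "{Inf K..Sup K} = K" using D(1) by (rule sym)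
      qed
      define G where "G K = f (Sup K) - f (Inf K)" for K
      have tot: "(\<Sum>(x, K)\<in>p. G K) = f b - f a"
        unfolding G_def using additive_tagged_division_1[OF \<open>a \<le> b\<close> p'] by blast
      have len: "(\<Sum>(x, K)\<in>p. Sup K - Inf K) = b - a"
        using additive_tagged_division_1[OF \<open>a \<le> b\<close> p', of "\<lambda>x. x"] by blast
      define p1 where "p1 = p \<inter> {z. fst z \<in> N}"
      define p2 where "p2 = p \<inter> {z. fst z \<notin> N}"
      have fin: "finite p1" "finite p2" and p12: "p = p1 \<union> p2" "p1 \<inter> p2 = {}"
        using \<open>finite p\<close> by (auto simp: p1_def p2_def)
      \<comment> \<open>Tags in the exceptional set: absolute continuity controls the increments of \<open>f\<close>.\<close>
      have bad: "(\<Sum>(x, K)\<in>p1. \<bar>G K\<bar>) < e / 2"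
      proof -
        have "p1 tagged_partial_division_of cbox a b"
          using p(1) tagged_partial_division_subset[of p "cbox a b" p1]
          by (simp add: tagged_division_of_def p12(1))
        then have t: "p1 tagged_division_of \<Union>(snd ` p1)" by (rule tagged_partial_division_of_Union_self)
        then have div: "snd ` p1 division_of \<Union>(snd ` p1)" by (rule division_of_tagged_division)
        have sub: "\<Union>(snd ` p1) \<subseteq> {a..b}" "\<Union>(snd ` p1) \<subseteq> U"
        proof -
          have KU: "K \<subseteq> {a..b} \<inter> U" if "(x, K) \<in> p1" for x K
          proof -
            have KK: "Inf K \<ge> a" "Sup K \<le> b" "{Inf K..Sup K} \<subseteq> U"
              using K[of x K] that by (auto simp: p1_def \<gamma>_def)
            then have sub: "{Inf K..Sup K} \<subseteq> {a..b} \<inter> U" by auto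
            have eq: "{Inf K..Sup K} = K" using that by (intro Keq[of x]) (simp add: p1_def)
            show ?thesis using sub unfolding eq .
          qed
          have "\<Union>(snd ` p1) \<subseteq> {a..b} \<inter> U"
          proof (rule Union_least)
            fix K assume "K \<in> snd ` p1"
            then obtain x where "(x, K) \<in> p1" by auto
            then show "K \<subseteq> {a..b} \<inter> U" by (rule KU)
          qed
          then show "\<Union>(snd ` p1) \<subseteq> {a..b}" "\<Union>(snd ` p1) \<subseteq> U" by simp_all
        qed
        have "(\<Sum>K\<in>snd ` p1. Sup K - Inf K) = measure lebesgue (\<Union>(snd ` p1))"
          by (rule sum_length_division_eq_measure[OF div])
        also have "\<dots> \<le> measure lebesgue U"
          using div U by (intro measure_mono_fmeasurable sub) (auto dest: lmeasurable_division)
        also have "\<dots> < \<delta>" by fact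
        finally have "(\<Sum>K\<in>snd ` p1. \<bar>f (Sup K) - f (Inf K)\<bar>) < e / 2"
          by (intro \<delta>(2)[OF div sub(1)])
        moreover have "(\<Sum>(x, K)\<in>p1. if K = {} then 0 else \<bar>G K\<bar>) = (\<Sum>K\<in>snd ` p1. if K = {} then 0 else \<bar>G K\<bar>)"
          by (rule sum.over_tagged_division_lemma[OF t]) (auto simp: G_def box_eq_empty)
        moreover have ne: "K \<noteq> {}" if "(x, K) \<in> p1" for x K
          using ptag(2)[of x K] that by (auto simp: p1_def)
        have "(\<Sum>(x, K)\<in>p1. if K = {} then 0 else \<bar>G K\<bar>) = (\<Sum>(x, K)\<in>p1. \<bar>G K\<bar>)"
        proof (intro sum.cong refl)
          fix z assume "z \<in> p1"
          then show "(case z of (x, K) \<Rightarrow> if K = {} then 0 else \<bar>G K\<bar>) = (case z of (x, K) \<Rightarrow> \<bar>G K\<bar>)"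
            using ne by (cases z) simp
        qed
        moreover have "(\<Sum>K\<in>snd ` p1. if K = {} then 0 else \<bar>G K\<bar>) = (\<Sum>K\<in>snd ` p1. \<bar>G K\<bar>)"
        proof (intro sum.cong refl)
          fix K assume "K \<in> snd ` p1"
          then obtain x where "(x, K) \<in> p1" by auto
          then show "(if K = {} then 0 else \<bar>G K\<bar>) = \<bar>G K\<bar>" using ne by simp
        qed
        ultimately show ?thesis by (simp add: G_def)
      qed
      have good: "\<bar>measure lborel K * h x - G K\<bar> \<le> \<eta> * (Sup K - Inf K)" if "(x, K) \<in> p2" for x K
      proof -
        have xK: "(x, K) \<in> p" "x \<notin> N" using that by (auto simp: p2_def)
        note KK = K[OF xK(1)]
        have x: "x \<in> {a..b} - N" using KK xK by auto
        have "{Inf K..Sup K} \<subseteq> ball x (d x)" "Inf K \<le> Sup K" using KK x by (auto simp: \<gamma>_def)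
        then have "Inf K \<in> ball x (d x)" "Sup K \<in> ball x (d x)" by auto
        then have "\<bar>f (Inf K) - f x - g x * (Inf K - x)\<bar> \<le> \<eta> * \<bar>Inf K - x\<bar>"
           "\<bar>f (Sup K) - f x - g x * (Sup K - x)\<bar> \<le> \<eta> * \<bar>Sup K - x\<bar>"
          using KK by (intro d(2)[OF x]; auto simp: dist_real_def)+
        moreover have "\<bar>Inf K - x\<bar> = x - Inf K" "\<bar>Sup K - x\<bar> = Sup K - x" using KK by auto
        ultimately have "\<bar>f (Inf K) - f x - g x * (Inf K - x)\<bar> \<le> \<eta> * (x - Inf K)"
           "\<bar>f (Sup K) - f x - g x * (Sup K - x)\<bar> \<le> \<eta> * (Sup K - x)" by auto
        then have "\<bar>g x * (Sup K - Inf K) - G K\<bar> \<le> \<eta> * (Sup K - Inf K)"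
          unfolding G_def by (auto simp: algebra_simps)
        then show ?thesis using KK xK by (simp add: h_def mult.commute)
      qed
      define S1 S2 where "S1 = (\<Sum>(x, K)\<in>p1. measure lborel K * h x - G K)"
        and "S2 = (\<Sum>(x, K)\<in>p2. measure lborel K * h x - G K)"
      have "(\<Sum>(x, K)\<in>p. measure lborel K *\<^sub>R h x) - (f b - f a) = (\<Sum>(x, K)\<in>p. measure lborel K * h x - G K)"
        unfolding tot[symmetric] by (simp add: sum_subtractf split_def)
      also have "\<dots> = S1 + S2"
        unfolding p12(1) S1_def S2_def using fin p12(2) by (intro sum.union_disjoint)
      finally have split: "(\<Sum>(x, K)\<in>p. measure lborel K *\<^sub>R h x) - (f b - f a) = S1 + S2" .
      have "norm S1 \<le> (\<Sum>(x, K)\<in>p1. \<bar>G K\<bar>)"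
        unfolding S1_def by (rule sum_norm_le) (auto simp: p1_def h_def)
      moreover have "norm S2 \<le> \<eta> * (b - a)"
      proof -
        have "norm S2 \<le> (\<Sum>z\<in>p2. \<eta> * (Sup (snd z) - Inf (snd z)))"
          unfolding S2_def
        proof (rule sum_norm_le)
          fix z assume "z \<in> p2"
          then show "norm (case z of (x, K) \<Rightarrow> measure lborel K * h x - G K) \<le> \<eta> * (Sup (snd z) - Inf (snd z))"
            using good[of "fst z" "snd z"] by (simp add: split_beta)
        qed
        also have "\<dots> \<le> (\<Sum>z\<in>p. \<eta> * (Sup (snd z) - Inf (snd z)))"
        proof (rule sum_mono2[OF \<open>finite p\<close>])
          show "p2 \<subseteq> p" by (simp add: p2_def)
          fix z assume "z \<in> p - p2"
          then have "(fst z, snd z) \<in> p" by simp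
          then have "Inf (snd z) \<le> Sup (snd z)" using K by (meson order_trans)
          then show "0 \<le> \<eta> * (Sup (snd z) - Inf (snd z))" using \<open>\<eta> > 0\<close> by simp
        qed
        also have "\<dots> = \<eta> * (b - a)"
          unfolding len[symmetric] by (simp add: sum_distrib_left split_def)
        finally show ?thesis .
      qed
      ultimately have "norm (S1 + S2) < e"
        using bad \<eta>(2) norm_triangle_ineq[of S1 S2] by linarith
      then show ?thesis unfolding split .
    qed
    show "\<exists>\<gamma>. gauge \<gamma> \<and> (\<forall>\<D>. \<D> tagged_division_of cbox a b \<and> \<gamma> fine \<D> \<longrightarrow>
        norm ((\<Sum>(x, K)\<in>\<D>. measure lborel K *\<^sub>R h x) - (f b - f a)) < e)"
      by (intro exI[of _ \<gamma>] conjI allI impI gauge close; elim conjE; assumption)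
  qed
  then have "(h has_integral f b - f a) {a..b}" unfolding box_real .
  then show ?thesis
    by (rule has_integral_spike[OF N, rotated]) (auto simp: h_def)
qed

section \<open>Indefinite integrals\<close>

text \<open>Split \<open>\<bar>f\<bar>\<close> into its truncation at a level \<open>n\<close> and the excess \<open>r\<close>. By dominated convergence the
integral of \<open>r\<close> is small for some \<open>n\<close>, and the truncation contributes at most \<open>n\<close> times the total
length.\<close>

theorem abs_continuous_on_indefinite_integral:
  fixes f :: "real \<Rightarrow> real"
  assumes f: "f absolutely_integrable_on {a..b}"
  shows "abs_continuous_on {a..b} (\<lambda>t. integral {a..t} f)"
  unfolding abs_continuous_on_def
proof (intro allI impI)
  fix \<epsilon> :: real assume "\<epsilon> > 0"
  have f_int: "f integrable_on {a..b}" and nf: "(\<lambda>x. \<bar>f x\<bar>) integrable_on {a..b}"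
    using f by (auto simp: absolutely_integrable_on_def)
  have nfa: "(\<lambda>x. \<bar>f x\<bar>) absolutely_integrable_on {a..b}"
    using nf by (intro nonnegative_absolutely_integrable_1) auto
  have minint: "(\<lambda>x. min \<bar>f x\<bar> (real n)) integrable_on {a..b}" for n
  proof -
    have "(\<lambda>x. \<Sum>i\<in>Basis. min (\<bar>f x\<bar> \<bullet> i) (real n \<bullet> i) *\<^sub>R i) absolutely_integrable_on {a..b}"
      by (intro absolutely_integrable_min nfa absolutely_integrable_on_const) auto
    then show ?thesis by (simp add: absolutely_integrable_on_def)
  qed
  have "(\<lambda>n. integral {a..b} (\<lambda>x. min \<bar>f x\<bar> (real n))) \<longlonglongrightarrow> integral {a..b} (\<lambda>x. \<bar>f x\<bar>)"
  proof (rule dominated_convergence(2)[OF minint nf])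
    fix x assume "x \<in> {a..b}"
    obtain n0 :: nat where n0: "\<bar>f x\<bar> \<le> real n0" using real_arch_simple by blast
    have "\<forall>\<^sub>F n in sequentially. min \<bar>f x\<bar> (real n) = \<bar>f x\<bar>"
      using eventually_ge_at_top[of n0] by eventually_elim (use n0 in auto)
    then show "(\<lambda>n. min \<bar>f x\<bar> (real n)) \<longlonglongrightarrow> \<bar>f x\<bar>" by (rule tendsto_eventually)
  qed auto
  then have "\<forall>\<^sub>F n in sequentially. integral {a..b} (\<lambda>x. \<bar>f x\<bar>) - \<epsilon> / 2 < integral {a..b} (\<lambda>x. min \<bar>f x\<bar> (real n))"
    using \<open>\<epsilon> > 0\<close> by (intro order_tendstoD(1)) auto
  then obtain n where n: "integral {a..b} (\<lambda>x. \<bar>f x\<bar>) - \<epsilon> / 2 < integral {a..b} (\<lambda>x. min \<bar>f x\<bar> (real n))"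
    using eventually_happens sequentially_bot by blast
  define r where "r x = \<bar>f x\<bar> - min \<bar>f x\<bar> (real n)" for x
  have r_int: "r integrable_on {a..b}" unfolding r_def by (intro integrable_diff nf minint)
  have r_small: "integral {a..b} r < \<epsilon> / 2"
    using n unfolding r_def by (subst integral_diff[OF nf minint]) linarith
  define \<delta> where "\<delta> = \<epsilon> / (2 * (real n + 1))"
  show "\<exists>\<delta>>0. \<forall>D T. D division_of T \<and> T \<subseteq> {a..b} \<and> (\<Sum>K\<in>D. Sup K - Inf K) < \<delta> \<longrightarrow>
        (\<Sum>K\<in>D. \<bar>integral {a..Sup K} f - integral {a..Inf K} f\<bar>) < \<epsilon>"
  proof (intro exI[of _ \<delta>] conjI allI impI)
    show "\<delta> > 0" using \<open>\<epsilon> > 0\<close> by (simp add: \<delta>_def)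
    fix D T assume A: "D division_of T \<and> T \<subseteq> {a..b} \<and> (\<Sum>K\<in>D. Sup K - Inf K) < \<delta>"
    then have D: "D division_of T" and T: "T \<subseteq> {a..b}" and len: "(\<Sum>K\<in>D. Sup K - Inf K) < \<delta>" by auto
    have Tint: "r integrable_on T"
      using T D r_int by (metis box_real(2) integrable_on_subdivision)
    have "(\<Sum>K\<in>D. \<bar>integral {a..Sup K} f - integral {a..Inf K} f\<bar>)
        \<le> (\<Sum>K\<in>D. integral K r + real n * (Sup K - Inf K))"
    proof (rule sum_mono)
      fix K assume "K \<in> D"
      note K = division_of_real_interval[OF D this]
      define u v where "u = Inf K" and "v = Sup K"
      have uv: "a \<le> u" "u \<le> v" "v \<le> b" using K(2-4) T by (auto simp: u_def v_def)
      have Kuv: "K = {u..v}" unfolding u_def v_def by (rule K(1))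
      have sub: "{u..v} \<subseteq> {a..b}" using uv by auto
      have "integral {a..u} f + integral {u..v} f = integral {a..v} f"
        using uv integrable_on_subinterval[OF f_int, of a v] by (intro Henstock_Kurzweil_Integration.integral_combine) auto
      then have "\<bar>integral {a..v} f - integral {a..u} f\<bar> = \<bar>integral {u..v} f\<bar>" by linarith
      also have "\<bar>integral {u..v} f\<bar> \<le> integral {u..v} (\<lambda>x. r x + real n)"
      proof -
        have "norm (f x) \<le> r x + real n" for x by (auto simp: r_def)
        moreover have "(\<lambda>x. r x + real n) integrable_on {u..v}"
          using integrable_on_subinterval[OF r_int sub] by (intro integrable_add integrable_const_ivl)
        ultimately show ?thesis
          using integral_norm_bound_integral[OF integrable_on_subinterval[OF f_int sub]] by fastforce
      qed
      also have "integral {u..v} (\<lambda>x. r x + real n) = integral {u..v} r + real n * (v - u)"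
        using integrable_on_subinterval[OF r_int sub] uv by (subst integral_add) auto
      finally show "\<bar>integral {a..Sup K} f - integral {a..Inf K} f\<bar> \<le> integral K r + real n * (Sup K - Inf K)"
        unfolding u_def[symmetric] v_def[symmetric] by (simp only: Kuv)
    qed
    also have "\<dots> = integral T r + real n * (\<Sum>K\<in>D. Sup K - Inf K)"
      using integral_combine_division_topdown[OF Tint D] by (simp add: sum.distrib sum_distrib_left)
    also have "integral T r \<le> integral {a..b} r"
      using Tint r_int T by (intro integral_subset_le) (auto simp: r_def)
    also have "real n * (\<Sum>K\<in>D. Sup K - Inf K) \<le> (real n + 1) * \<delta>"
      using len by (intro mult_mono) (auto simp: division_of_real_interval(2)[OF D] intro!: sum_nonneg)
    also have "(real n + 1) * \<delta> = \<epsilon> / 2" by (simp add: \<delta>_def field_simps)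
    finally show "(\<Sum>K\<in>D. \<bar>integral {a..Sup K} f - integral {a..Inf K} f\<bar>) < \<epsilon>"
      using r_small by simp
  qed
qed

text \<open>The exceptional sets of Lebesgue's differentiation theorem. If \<open>x\<close> lies in such a set, arbitrarily
short intervals around \<open>x\<close> violate the bound with constant \<open>c\<close>, so these intervals form a Vitali
covering. A disjoint countable subfamily covers almost all of the set, and Henstock's lemma bounds the
sum of the deviations, hence also \<open>c\<close> times the total length of any finite part of that subfamily, by
an arbitrarily small number.\<close>

lemma negligible_integral_deviation:
  fixes f :: "real \<Rightarrow> real"
  assumes f: "f integrable_on {a..b}" and "c > 0"
  shows "negligible {x. \<forall>d>0. \<exists>u v. a \<le> u \<and> v \<le> b \<and> u < v \<and> x \<in> {u..v} \<and> v - u < d \<and>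
           c * (v - u) < \<bar>f x * (v - u) - integral {u..v} f\<bar>}" (is "negligible ?B")
  unfolding negligible_outer_le
proof (intro allI impI)
  fix e :: real assume "e > 0"
  have "f integrable_on cbox a b" using f by simp
  then obtain \<gamma> where \<gamma>: "gauge \<gamma>"
    "\<And>p. p tagged_partial_division_of cbox a b \<Longrightarrow> \<gamma> fine p \<Longrightarrow>
        (\<Sum>(x, K)\<in>p. norm (measure lborel K *\<^sub>R f x - integral K f)) < c * e"
    by (rule Henstock_lemma[OF _ mult_pos_pos[OF \<open>c > 0\<close> \<open>e > 0\<close>]]) blast
  define good where "good x i \<longleftrightarrow> a \<le> fst i \<and> snd i \<le> b \<and> fst i < snd i \<and> x \<in> {fst i..snd i} \<and>
       {fst i..snd i} \<subseteq> \<gamma> x \<and>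
       c * (snd i - fst i) < \<bar>f x * (snd i - fst i) - integral {fst i..snd i} f\<bar>" for x i
  define I where "I = {i. \<exists>x. good x i}"
  \<comment> \<open>Midpoint and half length, so that the balls of the covering theorem are the given intervals.\<close>
  define m where "m i = (fst i + snd i) / 2" for i :: "real \<times> real"
  define r where "r i = (snd i - fst i) / 2" for i :: "real \<times> real"
  have ball: "cball (m i) (r i) = {fst i..snd i}" for i
    unfolding m_def r_def cball_eq_atLeastAtMost by (simp add: field_simps)
  obtain C where C: "countable C" "C \<subseteq> I"
     "pairwise (\<lambda>i j. disjnt (cball (m i) (r i)) (cball (m j) (r j))) C"
     "negligible (?B - (\<Union>i\<in>C. cball (m i) (r i)))"
  proof (rule Vitali_covering_theorem_cballs[of I r ?B m])
    show "0 < r i" if "i \<in> I" for i using that by (auto simp: I_def good_def r_def)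
    fix x d :: real assume x: "x \<in> ?B" and "0 < d"
    obtain d' where d': "d' > 0" "ball x d' \<subseteq> \<gamma> x"
      using gaugeD[OF \<gamma>(1), of x] by (auto elim: openE)
    have dd: "0 < min d d'" using \<open>0 < d\<close> \<open>d' > 0\<close> by simp
    from x[unfolded mem_Collect_eq, rule_format, OF dd] obtain u v where uv: "a \<le> u" "v \<le> b" "u < v" "x \<in> {u..v}" "v - u < min d d'"
      "c * (v - u) < \<bar>f x * (v - u) - integral {u..v} f\<bar>"
      by blast
    have "{u..v} \<subseteq> ball x d'" using uv by (auto simp: dist_real_def)
    then have "good x (u, v)" using uv d' by (auto simp: good_def)
    then show "\<exists>i. i \<in> I \<and> x \<in> cball (m i) (r i) \<and> r i < d"
    proof (intro exI[of _ "(u, v)"] conjI)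
      show "(u, v) \<in> I" using \<open>good x (u, v)\<close> unfolding I_def by blast
      show "x \<in> cball (m (u, v)) (r (u, v))" unfolding ball using uv by simp
      show "r (u, v) < d" using uv by (simp add: r_def)
    qed
  qed
  obtain tg where tg: "\<And>i. i \<in> I \<Longrightarrow> good (tg i) i" 
  proof -
    have "\<forall>i. \<exists>x. i \<in> I \<longrightarrow> good x i" by (auto simp: I_def)
    then show thesis using that by metis
  qed
  have bound: "measure lebesgue (\<Union>i\<in>F. {fst i..snd i}) \<le> e" if F: "F \<subseteq> C" "finite F" for F
  proof -
    have G: "good (tg i) i" if "i \<in> F" for i using tg F C that by blast
    have ne: "fst i < snd i" "a \<le> fst i" "snd i \<le> b" if "i \<in> F" for i
      using G[OF that] by (simp_all add: good_def)
    define p where "p = (\<lambda>i. (tg i, {fst i..snd i})) ` F"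
    have inj: "inj_on (\<lambda>i. (tg i, {fst i..snd i})) F"
    proof (rule inj_onI)
      fix i j assume "i \<in> F" "j \<in> F" "(tg i, {fst i..snd i}) = (tg j, {fst j..snd j})"
      then show "i = j" using ne[of i] ne[of j] by (simp add: Icc_eq_Icc prod_eq_iff)
    qed
    have "p tagged_partial_division_of cbox a b"
      unfolding tagged_partial_division_of_def
    proof (intro conjI allI impI)
      show "finite p" using F by (simp add: p_def)
      fix x K assume "(x, K) \<in> p"
      then obtain i where i: "i \<in> F" "x = tg i" "K = {fst i..snd i}" by (auto simp: p_def)
      show "x \<in> K" "K \<subseteq> cbox a b" "\<exists>a b. K = cbox a b"
        using G[OF i(1)] i by (auto simp: good_def intro: box_real(2)[symmetric])
    next
      fix x K x' K' assume "(x, K) \<in> p \<and> (x', K') \<in> p \<and> (x, K) \<noteq> (x', K')"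
      then obtain i j where ij: "i \<in> F" "K = {fst i..snd i}" "j \<in> F" "K' = {fst j..snd j}" "i \<noteq> j"
        by (auto simp: p_def)
      then have "disjnt K K'" using C(3) F unfolding pairwise_def ball by blast
      then show "interior K \<inter> interior K' = {}"
        unfolding disjnt_def using interior_subset by blast
    qed
    moreover have "\<gamma> fine p"
      unfolding fine_def p_def using G by (auto simp: good_def)
    ultimately have "(\<Sum>(x, K)\<in>p. norm (measure lborel K *\<^sub>R f x - integral K f)) < c * e" by (rule \<gamma>(2))
    also have "(\<Sum>(x, K)\<in>p. norm (measure lborel K *\<^sub>R f x - integral K f))
       = (\<Sum>i\<in>F. \<bar>f (tg i) * (snd i - fst i) - integral {fst i..snd i} f\<bar>)"
      unfolding p_def sum.reindex[OF inj] by (intro sum.cong) (use ne in \<open>auto simp: mult.commute less_imp_le\<close>)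
    finally have "(\<Sum>i\<in>F. \<bar>f (tg i) * (snd i - fst i) - integral {fst i..snd i} f\<bar>) < c * e" .
    moreover have "(\<Sum>i\<in>F. c * (snd i - fst i)) \<le> (\<Sum>i\<in>F. \<bar>f (tg i) * (snd i - fst i) - integral {fst i..snd i} f\<bar>)"
      by (rule sum_mono) (use G in \<open>simp add: good_def less_imp_le\<close>)
    ultimately have "c * (\<Sum>i\<in>F. snd i - fst i) < c * e" by (simp add: sum_distrib_left)
    then have "(\<Sum>i\<in>F. snd i - fst i) < e" using \<open>c > 0\<close> by simp
    moreover have "measure lebesgue (\<Union>i\<in>F. {fst i..snd i}) \<le> (\<Sum>i\<in>F. measure lebesgue {fst i..snd i})"
      using F by (intro measure_UNION_le) auto
    moreover have "(\<Sum>i\<in>F. measure lebesgue {fst i..snd i}) = (\<Sum>i\<in>F. snd i - fst i)"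
      by (intro sum.cong) (use ne in \<open>auto simp: less_imp_le\<close>)
    ultimately show ?thesis by linarith
  qed
  define B where "B = ?B"
  define V where "V = (\<Union>i\<in>C. {fst i..snd i})"
  have V: "V \<in> lmeasurable" "measure lebesgue V \<le> e"
    unfolding V_def using fmeasurable_UN_bound[OF C(1) _ bound] measure_UN_bound[OF C(1) _ bound] by auto
  have N: "negligible (B - V)" using C(4) by (simp only: ball B_def V_def)
  have "V \<union> (B - V) \<in> lmeasurable"
    by (rule fmeasurable.Un[OF V(1) negligible_imp_measurable[OF N]])
  moreover have "measure lebesgue (V \<union> (B - V)) \<le> measure lebesgue V + measure lebesgue (B - V)"
    by (rule measure_Un_le[OF fmeasurableD[OF V(1)] negligible_imp_sets[OF N]])
  then have "measure lebesgue (V \<union> (B - V)) \<le> e"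
    using negligible_imp_measure0[OF N] V by linarith
  moreover have "B \<subseteq> V \<union> (B - V)" by blast
  ultimately show "\<exists>T. ?B \<subseteq> T \<and> T \<in> lmeasurable \<and> measure lebesgue T \<le> e"
    unfolding B_def[symmetric] by blast
qed

text \<open>The derivative exists off the union of the countably many exceptional sets that belong to the
constants \<open>1 / (n + 1)\<close>.\<close>

theorem AE_has_derivative_indefinite_integral:
  fixes f :: "real \<Rightarrow> real"
  assumes f: "f integrable_on {a..b}"
  shows "AE x in lebesgue_on {a..b}. ((\<lambda>t. integral {a..t} f) has_real_derivative f x) (at x within {a..b})"
proof -
  define B where "B n = {x. \<forall>d>0. \<exists>u v. a \<le> u \<and> v \<le> b \<and> u < v \<and> x \<in> {u..v} \<and> v - u < d \<and>
           inverse (real (Suc n)) * (v - u) < \<bar>f x * (v - u) - integral {u..v} f\<bar>}" for n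
  have "negligible (\<Union>n. B n)"
    unfolding B_def using negligible_integral_deviation[OF f] by (intro negligible_countable_Union) auto
  moreover have "((\<lambda>t. integral {a..t} f) has_real_derivative f x) (at x within {a..b})"
    if x: "x \<in> {a..b} - (\<Union>n. B n)" for x
    unfolding has_field_derivative_def has_derivative_within_alt
  proof (intro conjI allI impI)
    show "bounded_linear ((*) (f x))" by (rule bounded_linear_mult_right)
    fix e :: real assume "e > 0"
    then obtain n where n: "inverse (real (Suc n)) < e" using reals_Archimedean by blast
    have "x \<notin> B n" using x by blast
    then obtain d where "d > 0" and nd: "\<not> (\<exists>u v. a \<le> u \<and> v \<le> b \<and> u < v \<and> x \<in> {u..v} \<and> v - u < d \<and>
           inverse (real (Suc n)) * (v - u) < \<bar>f x * (v - u) - integral {u..v} f\<bar>)"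
      unfolding B_def mem_Collect_eq by blast
    have d: "\<bar>f x * (v - u) - integral {u..v} f\<bar> \<le> inverse (real (Suc n)) * (v - u)"
      if "a \<le> u" "v \<le> b" "u < v" "x \<in> {u..v}" "v - u < d" for u v
    proof (rule ccontr)
      assume "\<not> ?thesis"
      then have "inverse (real (Suc n)) * (v - u) < \<bar>f x * (v - u) - integral {u..v} f\<bar>" by simp
      with nd that show False by blast
    qed
    have comb: "integral {a..v} f - integral {a..u} f = integral {u..v} f" if "a \<le> u" "u \<le> v" "v \<le> b" for u v
      using Henstock_Kurzweil_Integration.integral_combine[of a u v f] that integrable_on_subinterval[OF f, of a v] by auto
    have small: "\<bar>f x * (v - u) - integral {u..v} f\<bar> \<le> e * (v - u)"
      if "a \<le> u" "v \<le> b" "u < v" "x \<in> {u..v}" "v - u < d" for u v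
    proof -
      have "inverse (real (Suc n)) * (v - u) \<le> e * (v - u)"
        using n that by (intro mult_right_mono) auto
      then show ?thesis using d[OF that] by linarith
    qed
    show "\<exists>d>0. \<forall>y\<in>{a..b}. norm (y - x) < d \<longrightarrow>
       norm (integral {a..y} f - integral {a..x} f - f x * (y - x)) \<le> e * norm (y - x)"
    proof (intro exI[of _ d] conjI ballI impI)
      fix y assume y: "y \<in> {a..b}" "norm (y - x) < d"
      consider "y = x" | "x < y" | "y < x" by linarith
      then show "norm (integral {a..y} f - integral {a..x} f - f x * (y - x)) \<le> e * norm (y - x)"
      proof cases
        case 2
        then show ?thesis using small[of x y] comb[of x y] x y by auto
      next
        case 3
        then have "integral {a..y} f - integral {a..x} f - f x * (y - x) = f x * (x - y) - integral {y..x} f"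
          using comb[of y x] x y by (auto simp: algebra_simps)
        then show ?thesis using small[of y x] x y 3 by auto
      qed auto
    qed (fact \<open>d > 0\<close>)
  qed
  ultimately show ?thesis unfolding AE_lebesgue_on_iff_negligible by (intro exI[of _ "\<Union>n. B n"] conjI ballI)
qed

corollary abs_continuous_on_has_integral_derivative_upto:
  fixes f g :: "real \<Rightarrow> real"
  assumes f: "abs_continuous_on {a..b} f"
    and deriv: "AE x in lebesgue_on {a..b}. (f has_real_derivative g x) (at x within {a..b})"
    and t: "t \<in> {a..b}"
  shows "(g has_integral f t - f a) {a..t}"
proof (rule abs_continuous_on_has_integral_derivative)
  have sub: "{a..t} \<subseteq> {a..b}" using t by auto
  show "a \<le> t" using t by simp
  show "abs_continuous_on {a..t} f" by (rule abs_continuous_on_subset[OF f sub])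
  obtain N where N: "negligible N"
    and der: "\<And>x. x \<in> {a..b} - N \<Longrightarrow> (f has_real_derivative g x) (at x within {a..b})"
    using deriv unfolding AE_lebesgue_on_iff_negligible by metis
  have "(f has_real_derivative g x) (at x within {a..t})" if "x \<in> {a..t} - N" for x
    using that sub by (intro DERIV_subset[OF der sub]) auto
  then show "AE x in lebesgue_on {a..t}. (f has_real_derivative g x) (at x within {a..t})"
    unfolding AE_lebesgue_on_iff_negligible using N by (intro exI[of _ N]) simp
qed

lemma absolutely_integrable_mult_continuous:
  fixes f g :: "real \<Rightarrow> real"
  assumes "f absolutely_integrable_on {a..b}" and "continuous_on {a..b} g"
  shows "(\<lambda>x. f x * g x) absolutely_integrable_on {a..b}"
proof -
  have "(\<lambda>x. g x * f x) absolutely_integrable_on {a..b}"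
    using assms compact_continuous_image[OF assms(2)]
    by (intro absolutely_integrable_bounded_measurable_product_real
          continuous_imp_measurable_on_sets_lebesgue compact_imp_bounded) auto
  then show ?thesis by (simp add: mult.commute)
qed

section \<open>Existence for linear equations with integrable coefficients\<close>

text \<open>The equation \<open>u'' + q u = f\<close> as a first-order system, with the derivative \<open>v\<close> of \<open>u\<close> carried along
explicitly. Statements about \<open>v\<close> then need no reference to the chosen value of a derivative.\<close>

definition ode_solution ::
  "(real \<Rightarrow> real) \<Rightarrow> (real \<Rightarrow> real) \<Rightarrow> (real \<Rightarrow> real) \<Rightarrow> (real \<Rightarrow> real) \<Rightarrow> bool" where
  "ode_solution q f u v \<longleftrightarrow>
     (\<forall>t\<in>{0..1}. (u has_real_derivative v t) (at t within {0..1})) \<and> abs_continuous_on {0..1} v \<and>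
     (AE t in lebesgue_on {0..1}. (v has_real_derivative f t - q t * u t) (at t within {0..1}))"

text \<open>The weight is \<open>E t = exp (2 * Q t)\<close> with \<open>Q t\<close> the integral of \<open>\<bar>q\<bar>\<close> over \<open>{0..t}\<close>. It satisfies
\<open>E' = 2 \<bar>q\<bar> E\<close> almost everywhere, so integrating \<open>\<bar>q\<bar> E\<close> returns at most half of \<open>E\<close>. This factor one
half is the contraction constant in the existence proof.\<close>

lemma exp_integral_weight:
  fixes q :: "real \<Rightarrow> real"
  assumes q: "q absolutely_integrable_on {0..1}"
  obtains E where "continuous_on {0..1} E" "\<And>t. t \<in> {0..1} \<Longrightarrow> 1 \<le> E t"
    "\<And>r t. 0 \<le> r \<Longrightarrow> r \<le> t \<Longrightarrow> t \<le> 1 \<Longrightarrow> E r \<le> E t"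
    "\<And>t. t \<in> {0..1} \<Longrightarrow> ((\<lambda>s. \<bar>q s\<bar> * E s) has_integral (E t - 1) / 2) {0..t}"
proof -
  define Q where "Q t = integral {0..t} (\<lambda>s. \<bar>q s\<bar>)" for t
  define E where "E t = exp (2 * Q t)" for t
  have qi: "(\<lambda>s. \<bar>q s\<bar>) integrable_on {0..1}"
    using q by (simp add: absolutely_integrable_on_def)
  have qa: "(\<lambda>s. \<bar>q s\<bar>) absolutely_integrable_on {0..1}"
    using qi by (intro nonnegative_absolutely_integrable_1) auto
  have Q_mono: "Q r \<le> Q t" if "0 \<le> r" "r \<le> t" "t \<le> 1" for r t
    unfolding Q_def using that
    by (intro integral_subset_le integrable_on_subinterval[OF qi]) auto
  have Q0: "Q 0 = 0" by (simp add: Q_def)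
  have Q_ac: "abs_continuous_on {0..1} Q"
    unfolding Q_def by (rule abs_continuous_on_indefinite_integral[OF qa])
  have Q_deriv: "AE t in lebesgue_on {0..1}. (Q has_real_derivative \<bar>q t\<bar>) (at t within {0..1})"
    unfolding Q_def by (rule AE_has_derivative_indefinite_integral[OF qi])
  have lip: "\<bar>exp y - exp x\<bar> \<le> exp m * \<bar>y - x\<bar>" if "x \<le> m" "y \<le> m" for x y m :: real
  proof -
    have *: "exp y - exp x \<le> exp m * (y - x)" if "x \<le> y" "y \<le> m" for x y
    proof -
      have "exp y - exp x = exp y * (1 - exp (x - y))" by (simp add: exp_diff algebra_simps)
      also have "\<dots> \<le> exp y * (y - x)"
      proof (rule mult_left_mono)
        show "1 - exp (x - y) \<le> y - x" using exp_ge_add_one_self[of "x - y"] by linarith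
      qed simp
      also have "\<dots> \<le> exp m * (y - x)" using that by (intro mult_right_mono) auto
      finally show ?thesis .
    qed
    show ?thesis
      using *[of x y] *[of y x] that by (cases "x \<le> y") (auto simp: abs_if)
  qed
  have E_ac: "abs_continuous_on {0..1} E"
  proof (rule abs_continuous_on_dominated[OF Q_ac Q_ac, where C = "exp (2 * Q 1)"])
    fix x y :: real assume "x \<in> {0..1}" "y \<in> {0..1}"
    then have "\<bar>E y - E x\<bar> \<le> exp (2 * Q 1) * \<bar>2 * Q y - 2 * Q x\<bar>"
      unfolding E_def by (intro lip) (auto intro!: Q_mono)
    then show "\<bar>E y - E x\<bar> \<le> exp (2 * Q 1) * (\<bar>Q y - Q x\<bar> + \<bar>Q y - Q x\<bar>)"
      by (simp add: abs_if algebra_simps split: if_splits)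
  qed
  have E_deriv: "AE t in lebesgue_on {0..1}. (E has_real_derivative 2 * (\<bar>q t\<bar> * E t)) (at t within {0..1})"
    using Q_deriv
  proof eventually_elim
    case (elim t)
    then show ?case unfolding E_def
      by (auto intro!: derivative_eq_intros)
  qed
  show thesis
  proof (rule that[of E])
    show "continuous_on {0..1} E" by (rule abs_continuous_on_imp_continuous_on[OF E_ac])
    show "1 \<le> E t" if "t \<in> {0..1}" for t using Q_mono[of 0 t] that by (simp add: E_def Q0)
    show "E r \<le> E t" if "0 \<le> r" "r \<le> t" "t \<le> 1" for r t using Q_mono[OF that] by (simp add: E_def)
    show "((\<lambda>s. \<bar>q s\<bar> * E s) has_integral (E t - 1) / 2) {0..t}" if "t \<in> {0..1}" for t
    proof -
      have "((\<lambda>s. 2 * (\<bar>q s\<bar> * E s)) has_integral E t - E 0) {0..t}"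
        by (rule abs_continuous_on_has_integral_derivative_upto[OF E_ac E_deriv that])
      from has_integral_mult_right[OF this, of "1/2"] show ?thesis by (simp add: E_def Q0)
    qed
  qed
qed

text \<open>The integral equation \<open>u(t) = \<alpha> + \<beta> t - \<integral>\<^sub>0\<^sup>t \<integral>\<^sub>0\<^sup>r q u\<close> is solved by Banach's fixed point theorem. In the
supremum norm of \<open>u / E\<close> the right-hand side contracts with constant one half on the whole interval, so
no subdivision is needed. The unknown of the fixed point problem is \<open>w = u / E\<close>.\<close>

theorem ode_solution_exists:
  fixes q :: "real \<Rightarrow> real"
  assumes q: "q absolutely_integrable_on {0..1}"
  obtains u v where "ode_solution q (\<lambda>_. 0) u v" "u 0 = \<alpha>" "v 0 = \<beta>"
proof -
  obtain E where E_cont: "continuous_on {0..1} E" and E1: "\<And>t. t \<in> {0..1} \<Longrightarrow> 1 \<le> E t"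
    and E_mono: "\<And>r t. 0 \<le> r \<Longrightarrow> r \<le> t \<Longrightarrow> t \<le> 1 \<Longrightarrow> E r \<le> E t"
    and E_int: "\<And>t. t \<in> {0..1} \<Longrightarrow> ((\<lambda>s. \<bar>q s\<bar> * E s) has_integral (E t - 1) / 2) {0..t}"
    by (rule exp_integral_weight[OF q]) blast
  define H :: "(real \<Rightarrow>\<^sub>C real) \<Rightarrow> real \<Rightarrow> real"
    where "H w r = integral {0..r} (\<lambda>s. q s * (E s * w s))" for w r
  define F :: "(real \<Rightarrow>\<^sub>C real) \<Rightarrow> real \<Rightarrow> real"
    where "F w t = \<alpha> + \<beta> * t - integral {0..t} (H w)" for w t
  have Ew_cont: "continuous_on {0..1} (\<lambda>s. E s * w s)" for w :: "real \<Rightarrow>\<^sub>C real"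
    by (intro continuous_on_mult E_cont continuous_on_apply_bcontfun)
  have qEw: "(\<lambda>s. q s * (E s * w s)) absolutely_integrable_on {0..1}" for w :: "real \<Rightarrow>\<^sub>C real"
    by (rule absolutely_integrable_mult_continuous[OF q Ew_cont])
  have qEw_int: "(\<lambda>s. q s * (E s * w s)) integrable_on {0..r}" if "r \<le> 1" for w :: "real \<Rightarrow>\<^sub>C real" and r
  proof -
    have "(\<lambda>s. q s * (E s * w s)) integrable_on {0..1}"
      using qEw[of w] by (simp only: absolutely_integrable_on_def)
    then show ?thesis by (rule integrable_on_subinterval) (use that in auto)
  qed
  have H_cont: "continuous_on {0..1} (H w)" for w
    unfolding H_def by (rule indefinite_integral_continuous_1[OF qEw_int]) simp
  have F_deriv: "(F w has_real_derivative \<beta> - H w t) (at t within {0..1})" if "t \<in> {0..1}" for w t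
    unfolding F_def by (rule derivative_eq_intros integral_has_real_derivative[OF H_cont that] refl | simp)+
  have F_cont: "continuous_on {0..1} (F w)" for w
    by (rule DERIV_continuous_on[OF F_deriv])
  \<comment> \<open>The space of bounded continuous functions lives on the whole line, so \<open>w\<close> is extended by constants.\<close>
  define c :: "real \<Rightarrow> real" where "c t = max 0 (min 1 t)" for t
  have c: "c t \<in> {0..1}" for t by (simp add: c_def)
  define S where "S w = Bcontfun (\<lambda>t. F w (c t) / E (c t))" for w
  have S: "apply_bcontfun (S w) t = F w (c t) / E (c t)" for w t
  proof -
    have FE: "continuous_on {0..1} (\<lambda>t. F w t / E t)"
      using E1 by (intro continuous_on_divide F_cont E_cont) fastforce
    obtain M where M: "\<And>x. x \<in> {0..1} \<Longrightarrow> \<bar>F w x / E x\<bar> \<le> M"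
      by (rule continuous_on_interval_bound[OF FE]) blast
    have "continuous_on UNIV (\<lambda>t. F w (c t) / E (c t))"
      by (rule continuous_on_compose2[OF FE]) (auto simp: c_def intro!: continuous_intros)
    then have "(\<lambda>t. F w (c t) / E (c t)) \<in> bcontfun"
      by (rule bcontfun_normI[of _ M]) (use M[OF c] in \<open>simp add: real_norm_def\<close>)
    then show ?thesis by (simp add: S_def Bcontfun_inverse)
  qed
  have F_diff: "\<bar>F w t - F w' t\<bar> \<le> dist w w' / 2 * E t" if t: "t \<in> {0..1}" for w w' t
  proof -
    define d where "d = dist w w'"
    have d: "d \<ge> 0" "\<And>s. \<bar>w s - w' s\<bar> \<le> d"
      using dist_bounded[of w _ w'] by (auto simp: d_def dist_real_def)
    have H_diff: "\<bar>H w' r - H w r\<bar> \<le> d / 2 * E t" if r: "r \<in> {0..t}" for r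
    proof -
      have r1: "r \<in> {0..1}" using r t by auto
      have "H w' r - H w r = integral {0..r} (\<lambda>s. q s * (E s * w' s) - q s * (E s * w s))"
        unfolding H_def using r1 by (subst integral_diff) (auto intro!: qEw_int)
      also have "\<bar>\<dots>\<bar> \<le> integral {0..r} (\<lambda>s. \<bar>q s\<bar> * E s * d)"
      proof -
        have "norm (q s * (E s * w' s) - q s * (E s * w s)) \<le> \<bar>q s\<bar> * E s * d" if "s \<in> {0..r}" for s
        proof -
          have "s \<in> {0..1}" using that r1 by auto
          then have "E s \<ge> 0" using E1[of s] by linarith
          have "q s * (E s * w' s) - q s * (E s * w s) = - (q s * E s * (w s - w' s))" by algebra
          then have "norm (q s * (E s * w' s) - q s * (E s * w s)) = \<bar>q s\<bar> * E s * \<bar>w s - w' s\<bar>"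
            using \<open>E s \<ge> 0\<close> by (simp add: abs_mult)
          then show ?thesis using d(2)[of s] \<open>E s \<ge> 0\<close> by (simp add: mult_left_mono)
        qed
        moreover have "(\<lambda>s. \<bar>q s\<bar> * E s * d) integrable_on {0..r}"
          using E_int[OF r1] by (intro integrable_on_mult_left) blast
        moreover have "(\<lambda>s. q s * (E s * w' s) - q s * (E s * w s)) integrable_on {0..r}"
          using r1 by (intro integrable_diff qEw_int) auto
        ultimately show ?thesis
          unfolding real_norm_def[symmetric] by (intro integral_norm_bound_integral)
      qed
      also have "\<dots> = (E r - 1) / 2 * d"
        using integral_unique[OF E_int[OF r1]] by simp
      also have "\<dots> \<le> E t / 2 * d"
        using E_mono[of r t] r t d(1) by (intro mult_right_mono) auto
      finally show ?thesis by (simp add: mult.commute)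
    qed
    have Hi: "H w integrable_on {0..t}" for w
      using t by (intro integrable_continuous_real continuous_on_subset[OF H_cont]) auto
    have "F w t - F w' t = integral {0..t} (\<lambda>r. H w' r - H w r)"
      unfolding F_def by (subst integral_diff[OF Hi Hi]) simp
    also have "\<bar>\<dots>\<bar> \<le> d / 2 * E t * (t - 0)"
      unfolding real_norm_def[symmetric]
    proof (rule integral_bound)
      show "0 \<le> t" using t by simp
      show "continuous_on {0..t} (\<lambda>r. H w' r - H w r)"
        using t by (intro continuous_on_diff continuous_on_subset[OF H_cont]) auto
      show "norm (H w' r - H w r) \<le> d / 2 * E t" if "r \<in> {0..t}" for r
        unfolding real_norm_def using that by (rule H_diff)
    qed
    also have "\<dots> \<le> d / 2 * E t"
      using t d(1) E1[OF t] by (simp add: mult_left_le)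
    finally show ?thesis by (simp add: d_def)
  qed
  have "dist (S w) (S w') \<le> 1/2 * dist w w'" for w w'
  proof (rule dist_bound)
    fix t
    have pos: "E (c t) > 0" using E1[OF c] by (rule less_le_trans[OF zero_less_one])
    have "dist (S w t) (S w' t) = \<bar>F w (c t) - F w' (c t)\<bar> / E (c t)"
      unfolding S dist_real_def diff_divide_distrib[symmetric] using pos by simp
    also have "\<dots> \<le> (dist w w' / 2 * E (c t)) / E (c t)"
      using pos by (intro divide_right_mono F_diff c) auto
    finally show "dist (S w t) (S w' t) \<le> 1/2 * dist w w'" using pos by simp
  qed
  then have "\<exists>!w. S w = w" by (intro banach_fix_type[of "1/2"]) auto
  then obtain w where w: "S w = w" by blast
  have Fw: "F w t = E t * w t" if "t \<in> {0..1}" for t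
  proof -
    have "c t = t" using that by (simp add: c_def)
    then have "w t = F w t / E t" using S[of w t] w by simp
    then show ?thesis using E1[OF that] by simp
  qed
  show thesis
  proof (rule that[of "F w" "\<lambda>t. \<beta> - H w t"])
    show "F w 0 = \<alpha>" "\<beta> - H w 0 = \<beta>" by (simp_all add: F_def H_def)
    have "abs_continuous_on {0..1} (\<lambda>t. \<beta> - H w t)"
      unfolding H_def
      by (intro abs_continuous_on_diff abs_continuous_on_const abs_continuous_on_indefinite_integral qEw)
    moreover have "AE t in lebesgue_on {0..1}.
        ((\<lambda>t. \<beta> - H w t) has_real_derivative 0 - q t * F w t) (at t within {0..1})"
      using AE_has_derivative_indefinite_integral[OF qEw_int[OF order_refl, of w]] AE_space
    proof eventually_elim
      case (elim t)
      then have "F w t = E t * w t" by (intro Fw) simp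
      then show ?case using elim(1) unfolding H_def by (auto intro!: derivative_eq_intros)
    qed
    ultimately show "ode_solution q (\<lambda>_. 0) (F w) (\<lambda>t. \<beta> - H w t)"
      using F_deriv unfolding ode_solution_def by blast
  qed
qed

section \<open>Solutions and the function spaces\<close>

lemma dI_eq:
  assumes "(u has_real_derivative d) (at t within {0..1})" and "t \<in> {0..1}"
  shows "dI u t = d"
  unfolding dI_def
  using assms vector_derivative_within_closed_interval[of 0 1 t u d]
  by (simp add: has_real_derivative_iff_has_vector_derivative)

lemma ode_solution_dI: "ode_solution q f u v \<Longrightarrow> t \<in> {0..1} \<Longrightarrow> dI u t = v t"
  unfolding ode_solution_def by (intro dI_eq) auto

lemma abs_continuous_on_cong:
  assumes "abs_continuous_on S f" and "\<And>t. t \<in> S \<Longrightarrow> g t = f t"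
  shows "abs_continuous_on S g"
  by (rule abs_continuous_on_dominated[OF assms(1) abs_continuous_on_const[of S 0], where C = 1])
     (simp add: assms(2))

lemma ode_solution_cong:
  assumes "ode_solution q f u v"
    and u: "\<And>t. t \<in> {0..1} \<Longrightarrow> u' t = u t" and v: "\<And>t. t \<in> {0..1} \<Longrightarrow> v' t = v t"
  shows "ode_solution q f u' v'"
  unfolding ode_solution_def
proof (intro conjI ballI)
  fix t :: real assume t: "t \<in> {0..1}"
  have "(u has_real_derivative v t) (at t within {0..1})" using assms(1) t by (simp add: ode_solution_def)
  then show "(u' has_real_derivative v' t) (at t within {0..1})"
    unfolding v[OF t] by (rule has_field_derivative_transform_within[OF _ zero_less_one t]) (simp add: u)
next
  show "abs_continuous_on {0..1} v'"
    by (rule abs_continuous_on_cong[OF _ v]) (use assms(1) in \<open>simp_all add: ode_solution_def\<close>)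
next
  have "AE t in lebesgue_on {0..1}. (v has_real_derivative f t - q t * u t) (at t within {0..1})"
    using assms(1) by (simp add: ode_solution_def)
  then show "AE t in lebesgue_on {0..1}. (v' has_real_derivative f t - q t * u' t) (at t within {0..1})"
    using AE_space
  proof eventually_elim
    case (elim t)
    then have t: "t \<in> {0..1}" by simp
    show ?case unfolding u[OF t]
      by (rule has_field_derivative_transform_within[OF elim(1) zero_less_one t]) (simp add: v)
  qed
qed

text \<open>Where no derivative exists, \<open>dI\<close> returns an arbitrary number, so \<open>solves_ae\<close> has to demand the second
derivative separately. In the first-order system its existence is built into the equation for \<open>v\<close>.\<close>

lemma W21_solves_iff_ode_solution:
  "u \<in> W21 \<and> solves_ae a lam f u \<longleftrightarrow> ode_solution (\<lambda>t. a t + lam) f u (dI u)"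
proof
  assume "u \<in> W21 \<and> solves_ae a lam f u"
  then have u: "\<And>t. t \<in> {0..1} \<Longrightarrow> u differentiable (at t within {0..1})" "abs_continuous_on {0..1} (dI u)"
    and s: "AE t in lebesgue_on {0..1}. dI u differentiable (at t within {0..1}) \<and> L_op a lam u t = f t"
    by (auto simp: W21_def solves_ae_def)
  have dI: "(w has_real_derivative dI w t) (at t within {0..1})"
    if "w differentiable (at t within {0..1})" for w t
    using that unfolding dI_def has_real_derivative_iff_has_vector_derivative
    by (simp add: vector_derivative_works)
  from s have "AE t in lebesgue_on {0..1}. (dI u has_real_derivative f t - (a t + lam) * u t) (at t within {0..1})"
  proof eventually_elim
    case (elim t)
    then have "dI (dI u) t = f t - (a t + lam) * u t" by (simp add: L_op_def)
    then show ?case using dI[of "dI u" t] elim by simp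
  qed
  then show "ode_solution (\<lambda>t. a t + lam) f u (dI u)"
    using u dI unfolding ode_solution_def by simp
next
  assume sol: "ode_solution (\<lambda>t. a t + lam) f u (dI u)"
  then have d: "\<And>t. t \<in> {0..1} \<Longrightarrow> (u has_real_derivative dI u t) (at t within {0..1})"
    and ac: "abs_continuous_on {0..1} (dI u)"
    and ae: "AE t in lebesgue_on {0..1}. (dI u has_real_derivative f t - (a t + lam) * u t) (at t within {0..1})"
    by (auto simp: ode_solution_def)
  have diff: "w differentiable (at t within {0..1})" if "(w has_real_derivative x) (at t within {0..1})" for w x and t :: real
    using that unfolding has_field_derivative_def differentiable_def by blast
  have "u \<in> W21"
    unfolding W21_def using DERIV_continuous_on[OF d] diff[OF d] ac by simp
  moreover have "solves_ae a lam f u"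
    unfolding solves_ae_def using ae AE_space
  proof eventually_elim
    case (elim t)
    then have t: "t \<in> {0..1}" by simp
    show ?case using dI_eq[OF elim(1) t] diff[OF elim(1)] by (simp add: L_op_def)
  qed
  ultimately show "u \<in> W21 \<and> solves_ae a lam f u" by blast
qed

lemma ode_solution_imp_W21_solves:
  assumes "ode_solution (\<lambda>t. a t + lam) f u v"
  shows "u \<in> W21" and "solves_ae a lam f u"
proof -
  have "ode_solution (\<lambda>t. a t + lam) f u (dI u)"
    by (rule ode_solution_cong[OF assms refl]) (rule ode_solution_dI[OF assms])
  then show "u \<in> W21" "solves_ae a lam f u" using W21_solves_iff_ode_solution by blast+
qed

lemma ode_solution_lincomb:
  assumes "ode_solution q f u v" and "ode_solution q g w z"
  shows "ode_solution q (\<lambda>t. c * f t + d * g t) (\<lambda>t. c * u t + d * w t) (\<lambda>t. c * v t + d * z t)"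
  unfolding ode_solution_def
proof (intro conjI ballI)
  fix t :: real assume t: "t \<in> {0..1}"
  have "(u has_real_derivative v t) (at t within {0..1})" "(w has_real_derivative z t) (at t within {0..1})"
    using assms t by (simp_all add: ode_solution_def)
  then show "((\<lambda>t. c * u t + d * w t) has_real_derivative c * v t + d * z t) (at t within {0..1})"
    by (intro DERIV_add DERIV_cmult)
next
  have "abs_continuous_on {0..1} v" "abs_continuous_on {0..1} z"
    using assms by (simp_all add: ode_solution_def)
  then show "abs_continuous_on {0..1} (\<lambda>t. c * v t + d * z t)"
    by (intro abs_continuous_on_add abs_continuous_on_mult abs_continuous_on_const)
next
  have "AE t in lebesgue_on {0..1}. (v has_real_derivative f t - q t * u t) (at t within {0..1})"
    "AE t in lebesgue_on {0..1}. (z has_real_derivative g t - q t * w t) (at t within {0..1})"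
    using assms by (simp_all add: ode_solution_def)
  then show "AE t in lebesgue_on {0..1}. ((\<lambda>t. c * v t + d * z t) has_real_derivative
      c * f t + d * g t - q t * (c * u t + d * w t)) (at t within {0..1})"
  proof eventually_elim
    case (elim t)
    have "((\<lambda>t. c * v t + d * z t) has_real_derivative c * (f t - q t * u t) + d * (g t - q t * w t)) (at t within {0..1})"
      by (intro DERIV_add DERIV_cmult elim)
    then show ?case by (simp add: algebra_simps)
  qed
qed

lemma ode_solution_lincomb_hom:
  assumes "ode_solution q (\<lambda>_. 0) u v" and "ode_solution q (\<lambda>_. 0) w z"
  shows "ode_solution q (\<lambda>_. 0) (\<lambda>t. c * u t + d * w t) (\<lambda>t. c * v t + d * z t)"
  using ode_solution_lincomb[OF assms, of c d] by simp

lemma ode_solution_continuous: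
  assumes "ode_solution q f u v"
  shows "continuous_on {0..1} u" and "continuous_on {0..1} v"
  using assms unfolding ode_solution_def
  by (auto intro: abs_continuous_on_imp_continuous_on DERIV_continuous_on)

lemma ode_solution_abs_continuous:
  assumes "ode_solution q f u v"
  shows "abs_continuous_on {0..1} u"
proof -
  obtain M where M: "\<And>t. t \<in> {0..1} \<Longrightarrow> \<bar>v t\<bar> \<le> M"
    by (rule continuous_on_interval_bound[OF ode_solution_continuous(2)[OF assms]]) blast
  show ?thesis
  proof (rule abs_continuous_on_lipschitz)
    fix x y :: real assume xy: "x \<in> {0..1}" "y \<in> {0..1}"
    have "norm (u y - u x) \<le> M * norm (y - x)"
    proof (rule field_differentiable_bound[of "{0..1}" u v])
      show "(u has_field_derivative v z) (at z within {0..1})" if "z \<in> {0..1}" for z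
        using assms that by (simp add: ode_solution_def)
      show "norm (v z) \<le> M" if "z \<in> {0..1}" for z using M[OF that] by simp
    qed (use xy in auto)
    then show "\<bar>u y - u x\<bar> \<le> M * \<bar>y - x\<bar>" by simp
  qed
qed

section \<open>Variation of constants\<close>

text \<open>The Wronskian is absolutely continuous and its derivative vanishes almost everywhere, because the terms
with \<open>q\<close> cancel; the fundamental theorem then makes it constant.\<close>

lemma wronskian_const:
  assumes u: "ode_solution q (\<lambda>_. 0) u u'" and w: "ode_solution q (\<lambda>_. 0) w w'" and t: "t \<in> {0..1}"
  shows "u t * w' t - u' t * w t = u 0 * w' 0 - u' 0 * w 0"
proof -
  define W where "W t = u t * w' t - u' t * w t" for t
  have "abs_continuous_on {0..1} W"
    unfolding W_def using u w
    by (intro abs_continuous_on_diff abs_continuous_on_mult ode_solution_abs_continuous[OF u]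
          ode_solution_abs_continuous[OF w]) (auto simp: ode_solution_def)
  moreover have "AE t in lebesgue_on {0..1}. (W has_real_derivative 0) (at t within {0..1})"
  proof -
    have "AE t in lebesgue_on {0..1}. (u' has_real_derivative 0 - q t * u t) (at t within {0..1})"
      "AE t in lebesgue_on {0..1}. (w' has_real_derivative 0 - q t * w t) (at t within {0..1})"
      using u w by (simp_all add: ode_solution_def)
    then show ?thesis using AE_space
    proof eventually_elim
      case (elim t)
      then have "(u has_real_derivative u' t) (at t within {0..1})" "(w has_real_derivative w' t) (at t within {0..1})"
        using u w by (simp_all add: ode_solution_def)
      then have "(W has_real_derivative (u' t * w' t + (0 - q t * w t) * u t) - ((0 - q t * u t) * w t + w' t * u' t))
          (at t within {0..1})"
        unfolding W_def by (intro DERIV_diff DERIV_mult elim)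
      then show ?case by (simp add: algebra_simps)
    qed
  qed
  ultimately have "((\<lambda>_. 0) has_integral W t - W 0) {0..t}"
    using t by (rule abs_continuous_on_has_integral_derivative_upto)
  then have "W t - W 0 = 0" using has_integral_unique has_integral_0 by blast
  then show ?thesis by (simp add: W_def)
qed

locale fundamental_system =
  fixes q \<phi> \<phi>' \<psi> \<psi>' :: "real \<Rightarrow> real"
  assumes q: "q absolutely_integrable_on {0..1}"
    and \<phi>: "ode_solution q (\<lambda>_. 0) \<phi> \<phi>'" and \<phi>0: "\<phi> 0 = 1" "\<phi>' 0 = 0"
    and \<psi>: "ode_solution q (\<lambda>_. 0) \<psi> \<psi>'" and \<psi>0: "\<psi> 0 = 0" "\<psi>' 0 = 1"
begin

text \<open>\<open>k t s\<close> is the Cauchy function: as a function of \<open>t\<close> it is the homogeneous solution with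
  value \<open>0\<close> and slope \<open>1\<close> at \<open>t = s\<close>. \<open>k'\<close> is its derivative in \<open>t\<close>.\<close>

definition k :: "real \<Rightarrow> real \<Rightarrow> real" where "k t s = \<psi> t * \<phi> s - \<phi> t * \<psi> s"
definition k' :: "real \<Rightarrow> real \<Rightarrow> real" where "k' t s = \<psi>' t * \<phi> s - \<phi>' t * \<psi> s"

lemma wronskian: "t \<in> {0..1} \<Longrightarrow> \<phi> t * \<psi>' t - \<phi>' t * \<psi> t = 1"
  using wronskian_const[OF \<phi> \<psi>] by (simp add: \<phi>0 \<psi>0)

text \<open>Write the integral as \<open>p = \<psi> A - \<phi> B\<close> with indefinite integrals \<open>A\<close> of \<open>\<sigma> \<phi>\<close> and \<open>B\<close> of \<open>\<sigma> \<psi>\<close>. The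
product rule gives \<open>p' = \<psi>' A - \<phi>' B\<close>, at first only almost everywhere. Since \<open>p\<close> is absolutely
continuous and \<open>p'\<close> is continuous, the fundamental theorem promotes this to every point. In the
derivative of \<open>p'\<close> the factor of \<open>\<sigma>\<close> is the Wronskian, which equals \<open>1\<close>.\<close>

theorem variation_of_constants:
  assumes \<sigma>: "\<sigma> absolutely_integrable_on {0..1}"
  shows "ode_solution q \<sigma> (\<lambda>t. integral {0..t} (\<lambda>s. k t s * \<sigma> s)) (\<lambda>t. integral {0..t} (\<lambda>s. k' t s * \<sigma> s))"
proof -
  define A where "A t = integral {0..t} (\<lambda>s. \<sigma> s * \<phi> s)" for t
  define B where "B t = integral {0..t} (\<lambda>s. \<sigma> s * \<psi> s)" for t
  define p where "p t = \<psi> t * A t - \<phi> t * B t" for t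
  define p' where "p' t = \<psi>' t * A t - \<phi>' t * B t" for t
  note \<phi>_cont = ode_solution_continuous[OF \<phi>] and \<psi>_cont = ode_solution_continuous[OF \<psi>]
  note \<phi>_ac = ode_solution_abs_continuous[OF \<phi>] and \<psi>_ac = ode_solution_abs_continuous[OF \<psi>]
  have \<phi>'_ac: "abs_continuous_on {0..1} \<phi>'" and \<psi>'_ac: "abs_continuous_on {0..1} \<psi>'"
    using \<phi> \<psi> by (simp_all add: ode_solution_def)
  have a1: "(\<lambda>s. \<sigma> s * \<phi> s) absolutely_integrable_on {0..1}"
    and a2: "(\<lambda>s. \<sigma> s * \<psi> s) absolutely_integrable_on {0..1}"
    by (intro absolutely_integrable_mult_continuous \<sigma> \<phi>_cont \<psi>_cont)+
  have i1: "(\<lambda>s. \<sigma> s * \<phi> s) integrable_on {0..1}" and i2: "(\<lambda>s. \<sigma> s * \<psi> s) integrable_on {0..1}"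
    using a1 a2 by (simp_all add: absolutely_integrable_on_def)
  have A_ac: "abs_continuous_on {0..1} A" and B_ac: "abs_continuous_on {0..1} B"
    unfolding A_def B_def by (rule abs_continuous_on_indefinite_integral a1 a2)+
  have A_d: "AE t in lebesgue_on {0..1}. (A has_real_derivative \<sigma> t * \<phi> t) (at t within {0..1})"
    and B_d: "AE t in lebesgue_on {0..1}. (B has_real_derivative \<sigma> t * \<psi> t) (at t within {0..1})"
    unfolding A_def B_def by (rule AE_has_derivative_indefinite_integral i1 i2)+
  have p_ac: "abs_continuous_on {0..1} p" and p'_ac: "abs_continuous_on {0..1} p'"
    unfolding p_def p'_def
    by (intro abs_continuous_on_diff abs_continuous_on_mult \<phi>_ac \<psi>_ac \<phi>'_ac \<psi>'_ac A_ac B_ac)+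
  have d0: "(\<phi> has_real_derivative \<phi>' t) (at t within {0..1})" "(\<psi> has_real_derivative \<psi>' t) (at t within {0..1})"
    if "t \<in> {0..1}" for t using \<phi> \<psi> that by (simp_all add: ode_solution_def)
  have p_d: "AE t in lebesgue_on {0..1}. (p has_real_derivative p' t) (at t within {0..1})"
    using A_d B_d AE_space
  proof eventually_elim
    case (elim t)
    then have t: "t \<in> {0..1}" by simp
    have "(p has_real_derivative (\<psi>' t * A t + (\<sigma> t * \<phi> t) * \<psi> t) - (\<phi>' t * B t + (\<sigma> t * \<psi> t) * \<phi> t))
        (at t within {0..1})"
      unfolding p_def by (intro DERIV_diff DERIV_mult elim d0 t)
    then show ?case by (simp add: p'_def algebra_simps)
  qed
  have p'_cont: "continuous_on {0..1} p'" by (rule abs_continuous_on_imp_continuous_on[OF p'_ac])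
  have p_deriv: "(p has_real_derivative p' t) (at t within {0..1})" if t: "t \<in> {0..1}" for t
  proof -
    have eq: "integral {0..x} p' = p x" if "x \<in> {0..1}" for x
      using integral_unique[OF abs_continuous_on_has_integral_derivative_upto[OF p_ac p_d that]]
      by (simp add: p_def A_def B_def)
    show ?thesis
      by (rule has_field_derivative_transform_within[OF integral_has_real_derivative[OF p'_cont t] zero_less_one t])
         (simp add: eq)
  qed
  have "AE t in lebesgue_on {0..1}. (\<phi>' has_real_derivative 0 - q t * \<phi> t) (at t within {0..1})"
    "AE t in lebesgue_on {0..1}. (\<psi>' has_real_derivative 0 - q t * \<psi> t) (at t within {0..1})"
    using \<phi> \<psi> by (simp_all add: ode_solution_def)
  then have p'_d: "AE t in lebesgue_on {0..1}. (p' has_real_derivative \<sigma> t - q t * p t) (at t within {0..1})"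
    using A_d B_d AE_space
  proof eventually_elim
    case (elim t)
    then have t: "t \<in> {0..1}" by simp
    have "(p' has_real_derivative ((0 - q t * \<psi> t) * A t + (\<sigma> t * \<phi> t) * \<psi>' t)
         - ((0 - q t * \<phi> t) * B t + (\<sigma> t * \<psi> t) * \<phi>' t)) (at t within {0..1})"
      unfolding p'_def by (intro DERIV_diff DERIV_mult elim)
    also have "((0 - q t * \<psi> t) * A t + (\<sigma> t * \<phi> t) * \<psi>' t) - ((0 - q t * \<phi> t) * B t + (\<sigma> t * \<psi> t) * \<phi>' t)
        = \<sigma> t * (\<phi> t * \<psi>' t - \<phi>' t * \<psi> t) - q t * p t"
      by (simp add: p_def algebra_simps)
    finally show ?case by (simp add: wronskian[OF t])
  qed
  have "ode_solution q \<sigma> p p'"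
    unfolding ode_solution_def using p_deriv p'_ac p'_d by blast
  then show ?thesis
  proof (rule ode_solution_cong)
    fix t :: real assume t: "t \<in> {0..1}"
    have i: "(\<lambda>s. \<sigma> s * \<phi> s) integrable_on {0..t}" "(\<lambda>s. \<sigma> s * \<psi> s) integrable_on {0..t}"
      using t by (auto intro!: integrable_on_subinterval[OF i1] integrable_on_subinterval[OF i2])
    have *: "integral {0..t} (\<lambda>s. (x * \<phi> s - y * \<psi> s) * \<sigma> s) = x * A t - y * B t" for x y
    proof -
      have "integral {0..t} (\<lambda>s. (x * \<phi> s - y * \<psi> s) * \<sigma> s)
          = integral {0..t} (\<lambda>s. x * (\<sigma> s * \<phi> s) - y * (\<sigma> s * \<psi> s))"
        by (simp add: algebra_simps)
      also have "\<dots> = x * A t - y * B t"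
        unfolding A_def B_def by (subst integral_diff) (use i in \<open>simp_all add: integrable_on_mult_right\<close>)
      finally show ?thesis .
    qed
    show "integral {0..t} (\<lambda>s. k t s * \<sigma> s) = p t" "integral {0..t} (\<lambda>s. k' t s * \<sigma> s) = p' t"
      unfolding k_def k'_def p_def p'_def by (rule *)+
  qed
qed

end

section \<open>Green's functions\<close>

context fundamental_system
begin

text \<open>The general shape of a Green's function for two-point boundary conditions. Integrated against \<open>\<sigma>\<close> it gives
the particular solution \<open>p\<close> with zero initial data, corrected by \<open>p(1) \<omega> + p'(1) \<eta>\<close>; the homogeneous
solutions \<open>\<omega>\<close> and \<open>\<eta>\<close> encode the boundary conditions.\<close>

definition green_kernel :: "(real \<Rightarrow> real) \<Rightarrow> (real \<Rightarrow> real) \<Rightarrow> real \<Rightarrow> real \<Rightarrow> real" where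
  "green_kernel \<omega> \<eta> t s = (if s \<le> t then k t s else 0) + \<omega> t * k 1 s + \<eta> t * k' 1 s"

text \<open>The hypothesis \<open>bc\<close> says that the correction restores the boundary conditions: \<open>\<alpha>\<close> and \<open>\<beta>\<close> stand for the
value and the slope at \<open>1\<close> of the particular solution, whose value and slope at \<open>0\<close> vanish. Hence the
integral of the kernel against \<open>\<sigma>\<close> solves the problem. That every solution has this form is then
immediate from nonresonance, applied to the difference of two solutions.\<close>

lemma is_green_green_kernel:
  assumes a: "q = (\<lambda>t. a t + lam)"
    and \<omega>: "ode_solution q (\<lambda>_. 0) \<omega> \<omega>'" and \<eta>: "ode_solution q (\<lambda>_. 0) \<eta> \<eta>'"
    and X: "X \<subseteq> W21" and diff: "\<And>u w. u \<in> X \<Longrightarrow> w \<in> X \<Longrightarrow> (\<lambda>t. u t - w t) \<in> X"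
    and bc: "\<And>u \<alpha> \<beta>. u \<in> W21 \<Longrightarrow> u 0 = \<alpha> * \<omega> 0 + \<beta> * \<eta> 0 \<Longrightarrow> dI u 0 = \<alpha> * \<omega>' 0 + \<beta> * \<eta>' 0 \<Longrightarrow>
        u 1 = \<alpha> + (\<alpha> * \<omega> 1 + \<beta> * \<eta> 1) \<Longrightarrow> dI u 1 = \<beta> + (\<alpha> * \<omega>' 1 + \<beta> * \<eta>' 1) \<Longrightarrow> u \<in> X"
    and nonres: "nonresonant X a lam"
  shows "is_green X a lam (green_kernel \<omega> \<eta>)"
  unfolding is_green_def
proof (intro conjI allI impI)
  note conts = ode_solution_continuous[OF \<phi>] ode_solution_continuous[OF \<psi>]
    ode_solution_continuous[OF \<omega>] ode_solution_continuous[OF \<eta>]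
  \<comment> \<open>The cut-off at the diagonal becomes continuous because \<open>k s s = 0\<close>.\<close>
  have kern: "green_kernel \<omega> \<eta> t s = k (max t s) s + \<omega> t * k 1 s + \<eta> t * k' 1 s" for t s
    by (auto simp: green_kernel_def k_def max_def)
  show "continuous_on ({0..1} \<times> {0..1}) (\<lambda>(t, s). green_kernel \<omega> \<eta> t s)"
    unfolding kern k_def k'_def split_beta
    by (intro continuous_intros continuous_on_compose2[OF conts(1)] continuous_on_compose2[OF conts(2)]
          continuous_on_compose2[OF conts(3)] continuous_on_compose2[OF conts(4)]
          continuous_on_compose2[OF conts(5)] continuous_on_compose2[OF conts(7)]) auto
  fix \<sigma> :: "real \<Rightarrow> real" and u :: "real \<Rightarrow> real"
  assume \<sigma>: "\<sigma> absolutely_integrable_on {0..1}"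
  define p where "p t = integral {0..t} (\<lambda>s. k t s * \<sigma> s)" for t
  define p' where "p' t = integral {0..t} (\<lambda>s. k' t s * \<sigma> s)" for t
  define U where "U t = p t + (p 1 * \<omega> t + p' 1 * \<eta> t)" for t
  define V where "V t = p' t + (p 1 * \<omega>' t + p' 1 * \<eta>' t)" for t
  have "ode_solution q (\<lambda>t. 1 * \<sigma> t + 1 * 0) (\<lambda>t. 1 * p t + 1 * (p 1 * \<omega> t + p' 1 * \<eta> t))
     (\<lambda>t. 1 * p' t + 1 * (p 1 * \<omega>' t + p' 1 * \<eta>' t))"
    unfolding p_def p'_def
    by (intro ode_solution_lincomb variation_of_constants \<sigma> ode_solution_lincomb_hom \<omega> \<eta>)
  then have UV: "ode_solution q \<sigma> U V"
    unfolding U_def V_def by simp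
  have X_sol: "w \<in> X \<and> solves_ae a lam \<sigma> w" if w: "\<And>t. t \<in> {0..1} \<Longrightarrow> w t = U t" for w
  proof -
    have wV: "ode_solution q \<sigma> w V" by (rule ode_solution_cong[OF UV w refl])
    note W = ode_solution_imp_W21_solves[OF wV[unfolded a]]
    have "p 0 = 0" "p' 0 = 0" by (simp_all add: p_def p'_def)
    then have "w \<in> X"
      by (intro bc[of w "p 1" "p' 1"] W(1)) (simp_all add: w ode_solution_dI[OF wV] U_def V_def)
    then show ?thesis using W(2) by blast
  qed
  have int: "(LINT s:{0..1}|lebesgue. green_kernel \<omega> \<eta> t s * \<sigma> s) = U t" if t: "t \<in> {0..1}" for t
  proof -
    have cont: "continuous_on {0..1} (k x)" "continuous_on {0..1} (k' x)" for x
      unfolding k_def k'_def by (intro continuous_intros conts)+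
    have kint: "(\<lambda>s. k x s * \<sigma> s) integrable_on {0..1}" "(\<lambda>s. k' x s * \<sigma> s) integrable_on {0..1}" for x
      using absolutely_integrable_mult_continuous[OF \<sigma> cont(1)[of x]]
        absolutely_integrable_mult_continuous[OF \<sigma> cont(2)[of x]]
      by (simp_all add: absolutely_integrable_on_def mult.commute)
    have h1: "((\<lambda>s. (if s \<le> t then k t s else 0) * \<sigma> s) has_integral p t) {0..1}"
    proof -
      have "(\<lambda>s. k t s * \<sigma> s) integrable_on {0..t}"
        using t by (intro integrable_on_subinterval[OF kint(1)]) auto
      then have "((\<lambda>s. k t s * \<sigma> s) has_integral p t) {0..t}"
        unfolding p_def by (rule integrable_integral)
      then have "((\<lambda>s. if s \<in> {0..t} then k t s * \<sigma> s else 0) has_integral p t) {0..1}"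
        using t by (subst has_integral_restrict) auto
      then show ?thesis
        by (rule has_integral_eq[rotated]) auto
    qed
    have h2: "((\<lambda>s. k 1 s * \<sigma> s) has_integral p 1) {0..1}" "((\<lambda>s. k' 1 s * \<sigma> s) has_integral p' 1) {0..1}"
      unfolding p_def p'_def by (rule integrable_integral kint)+
    have "((\<lambda>s. (if s \<le> t then k t s else 0) * \<sigma> s + (\<omega> t * (k 1 s * \<sigma> s) + \<eta> t * (k' 1 s * \<sigma> s)))
        has_integral p t + (\<omega> t * p 1 + \<eta> t * p' 1)) {0..1}"
      by (intro has_integral_add has_integral_mult_right h1 h2)
    then have hi: "((\<lambda>s. green_kernel \<omega> \<eta> t s * \<sigma> s) has_integral U t) {0..1}"
      by (simp add: green_kernel_def U_def algebra_simps)
    have "continuous_on {0..1} (\<lambda>s. green_kernel \<omega> \<eta> t s)"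
      unfolding kern k_def k'_def using t
      by (intro continuous_intros continuous_on_compose2[OF conts(1)] continuous_on_compose2[OF conts(3)]) auto
    then have "(\<lambda>s. \<sigma> s * green_kernel \<omega> \<eta> t s) absolutely_integrable_on {0..1}"
      by (rule absolutely_integrable_mult_continuous[OF \<sigma>])
    then have "(LINT s:{0..1}|lebesgue. green_kernel \<omega> \<eta> t s * \<sigma> s) = integral {0..1} (\<lambda>s. green_kernel \<omega> \<eta> t s * \<sigma> s)"
      by (intro set_lebesgue_integral_eq_integral(2)) (simp add: mult.commute)
    then show ?thesis using integral_unique[OF hi] by simp
  qed
  show "u \<in> X \<and> solves_ae a lam \<sigma> u \<longleftrightarrow>
    (\<forall>t\<in>{0..1}. u t = (LINT s:{0..1}|lebesgue. green_kernel \<omega> \<eta> t s * \<sigma> s))"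
  proof
    assume u: "u \<in> X \<and> solves_ae a lam \<sigma> u"
    have U: "U \<in> X \<and> solves_ae a lam \<sigma> U" by (rule X_sol) simp
    have "ode_solution q \<sigma> u (dI u)" 
      using u X unfolding a by (intro W21_solves_iff_ode_solution[THEN iffD1]) auto
    from ode_solution_lincomb[OF this UV, of 1 "-1"]
    have "ode_solution q (\<lambda>_. 0) (\<lambda>t. u t - U t) (\<lambda>t. dI u t - V t)" by simp
    then have "solves_ae a lam (\<lambda>_. 0) (\<lambda>t. u t - U t)"
      unfolding a by (rule ode_solution_imp_W21_solves)
    moreover have "(\<lambda>t. u t - U t) \<in> X" using diff u U by blast
    ultimately have "\<forall>t\<in>{0..1}. u t - U t = 0" using nonres unfolding nonresonant_def by blast
    then show "\<forall>t\<in>{0..1}. u t = (LINT s:{0..1}|lebesgue. green_kernel \<omega> \<eta> t s * \<sigma> s)" by (simp add: int)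
  next
    assume "\<forall>t\<in>{0..1}. u t = (LINT s:{0..1}|lebesgue. green_kernel \<omega> \<eta> t s * \<sigma> s)"
    then show "u \<in> X \<and> solves_ae a lam \<sigma> u" by (intro X_sol) (simp add: int)
  qed
qed

end

text \<open>Both kernels represent the same solution for every right-hand side. Taking the difference of the two
kernels at a fixed \<open>t\<close> as right-hand side makes the integral of its square vanish.\<close>

lemma is_green_unique:
  assumes G: "is_green X a lam G" and G': "is_green X a lam G'" and t: "t \<in> {0..1}" and s: "s \<in> {0..1}"
  shows "G t s = G' t s"
proof -
  have sec: "continuous_on {0..1} (\<lambda>s. H t s)" if "is_green X a lam H" for H
  proof -
    have "continuous_on ({0..1} \<times> {0..1}) (\<lambda>z. case z of (t, s) \<Rightarrow> H t s)"
      using that by (simp add: is_green_def)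
    then have "continuous_on {0..1} (\<lambda>s. case (t, s) of (t, s) \<Rightarrow> H t s)"
      by (rule continuous_on_compose2) (use t in \<open>auto intro!: continuous_intros\<close>)
    then show ?thesis by simp
  qed
  define \<sigma> where "\<sigma> s = G t s - G' t s" for s
  have \<sigma>c: "continuous_on {0..1} \<sigma>" unfolding \<sigma>_def by (intro continuous_on_diff sec G G')
  have \<sigma>: "\<sigma> absolutely_integrable_on {0..1}" by (rule absolutely_integrable_continuous_real[OF \<sigma>c])
  define u where "u t = (LINT s:{0..1}|lebesgue. G t s * \<sigma> s)" for t
  have "u \<in> X \<and> solves_ae a lam \<sigma> u"
    using G \<sigma> unfolding is_green_def u_def by blast
  then have "u t = (LINT s:{0..1}|lebesgue. G' t s * \<sigma> s)"
    using G' \<sigma> t unfolding is_green_def by blast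
  moreover have "(LINT s:{0..1}|lebesgue. H t s * \<sigma> s) = integral {0..1} (\<lambda>s. H t s * \<sigma> s)"
    if "is_green X a lam H" for H
    by (intro set_lebesgue_integral_eq_integral(2) absolutely_integrable_continuous_real
          continuous_on_mult \<sigma>c sec that)
  ultimately have "integral {0..1} (\<lambda>s. G t s * \<sigma> s) = integral {0..1} (\<lambda>s. G' t s * \<sigma> s)"
    using G G' by (simp add: u_def)
  then have "integral {0..1} (\<lambda>s. G t s * \<sigma> s - G' t s * \<sigma> s) = 0"
  proof (subst integral_diff)
    show "(\<lambda>s. G t s * \<sigma> s) integrable_on {0..1}" "(\<lambda>s. G' t s * \<sigma> s) integrable_on {0..1}"
      by (intro integrable_continuous_real continuous_on_mult \<sigma>c sec[OF G] sec[OF G'])+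
  qed simp
  then have "integral {0..1} (\<lambda>s. \<sigma> s * \<sigma> s) = 0" by (simp add: \<sigma>_def algebra_simps)
  moreover have "continuous_on {0..1} (\<lambda>s. \<sigma> s * \<sigma> s)" by (intro continuous_on_mult \<sigma>c)
  ultimately have "\<forall>s\<in>{0..1}. \<sigma> s * \<sigma> s = 0"
    by (subst (asm) integral_eq_0_iff) simp_all
  then have "\<sigma> s = 0" using s by simp
  then show ?thesis by (simp add: \<sigma>_def)
qed

lemma green_eq:
  assumes "is_green X a lam G" and "t \<in> {0..1}" and "s \<in> {0..1}"
  shows "green X a lam t s = G t s"
proof (rule is_green_unique[OF _ assms])
  show "is_green X a lam (green X a lam)"
    unfolding green_def by (rule someI[of "is_green X a lam", OF assms(1)])
qed

lemma ext_cont_eq: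
  assumes f: "\<And>x. x \<in> {0<..<1} \<Longrightarrow> f x = g x" and g: "continuous_on {0..1} g" and x: "x \<in> {0..1}"
  shows "ext_cont f x = g x"
proof (cases "x \<in> {0<..<1}")
  case True then show ?thesis by (simp add: ext_cont_def f)
next
  case False
  have "x = 0 \<or> x = 1" using x False by auto
  then have "x islimpt {0<..<1}"
    using islimpt_greaterThanLessThan1[of 0 "1::real"] islimpt_greaterThanLessThan2[of 0 "1::real"] by auto
  then have nt: "\<not> trivial_limit (at x within {0<..<1})" by (simp add: trivial_limit_within)
  have "(g \<longlongrightarrow> g x) (at x within {0..1})" using g x by (simp add: continuous_on)
  then have "(g \<longlongrightarrow> g x) (at x within {0<..<1})" by (rule tendsto_within_subset) auto
  then have "(f \<longlongrightarrow> g x) (at x within {0<..<1})"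
    by (rule Lim_transform_eventually) (simp add: eventually_at_filter f)
  then have "Lim (at x within {0<..<1}) f = g x" by (rule tendsto_Lim[OF nt])
  then show ?thesis using False unfolding ext_cont_def by (simp only: if_False)
qed

text \<open>A homogeneous \<open>2 \<times> 2\<close> system with only the trivial solution has nonzero determinant: otherwise
\<open>(d, -c)\<close> and \<open>(-b, a)\<close> are solutions,
so all coefficients vanish and every vector is a solution.\<close>

lemma linear_system_2_solvable:
  fixes a b c d e f :: real
  assumes "\<And>x y. a * x + b * y = 0 \<Longrightarrow> c * x + d * y = 0 \<Longrightarrow> x = 0 \<and> y = 0"
  obtains x y where "a * x + b * y = e" and "c * x + d * y = f"
proof -
  define D where "D = a * d - b * c"
  have "D \<noteq> 0"
  proof
    assume "D = 0"
    then have "d = 0 \<and> c = 0" using assms[of d "- c"] by (simp add: D_def algebra_simps)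
    moreover have "b = 0 \<and> a = 0" using assms[of "- b" a] \<open>D = 0\<close> by (simp add: D_def algebra_simps)
    ultimately show False using assms[of 1 0] by simp
  qed
  show thesis
  proof (rule that[of "(d * e - b * f) / D" "(a * f - c * e) / D"])
    show "a * ((d * e - b * f) / D) + b * ((a * f - c * e) / D) = e"
      "c * ((d * e - b * f) / D) + d * ((a * f - c * e) / D) = f"
      using \<open>D \<noteq> 0\<close> by (simp_all add: field_simps) (simp_all add: D_def algebra_simps)
  qed
qed

section \<open>The periodic and the mixed problem\<close>

lemma W21_has_derivative:
  assumes "u \<in> W21" and "t \<in> {0..1}"
  shows "(u has_real_derivative dI u t) (at t within {0..1})"
  using assms unfolding W21_def dI_def has_real_derivative_iff_has_vector_derivative
  by (auto simp: vector_derivative_works)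

lemma W21_diff:
  assumes u: "u \<in> W21" and w: "w \<in> W21"
  shows "(\<lambda>t. u t - w t) \<in> W21" and "\<And>t. t \<in> {0..1} \<Longrightarrow> dI (\<lambda>t. u t - w t) t = dI u t - dI w t"
proof -
  have d: "((\<lambda>t. u t - w t) has_real_derivative dI u t - dI w t) (at t within {0..1})" if "t \<in> {0..1}" for t
    by (intro DERIV_diff W21_has_derivative u w that)
  show dI: "dI (\<lambda>t. u t - w t) t = dI u t - dI w t" if "t \<in> {0..1}" for t
    by (rule dI_eq[OF d[OF that] that])
  have "abs_continuous_on {0..1} (\<lambda>t. dI u t - dI w t)"
    using u w by (intro abs_continuous_on_diff) (simp_all add: W21_def)
  then have "abs_continuous_on {0..1} (dI (\<lambda>t. u t - w t))"
    by (rule abs_continuous_on_cong) (rule dI)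
  moreover have "(\<lambda>t. u t - w t) differentiable (at t within {0..1})" if "t \<in> {0..1}" for t
    using d[OF that] unfolding has_field_derivative_def differentiable_def by blast
  ultimately show "(\<lambda>t. u t - w t) \<in> W21"
    using DERIV_continuous_on[OF d] by (simp add: W21_def)
qed

lemma X_P_diff: "u \<in> X_P \<Longrightarrow> w \<in> X_P \<Longrightarrow> (\<lambda>t. u t - w t) \<in> X_P"
  by (simp add: X_P_def W21_diff)

lemma X_M1_diff: "u \<in> X_M1 \<Longrightarrow> w \<in> X_M1 \<Longrightarrow> (\<lambda>t. u t - w t) \<in> X_M1"
  by (simp add: X_M1_def W21_diff)

locale hill_equation = fundamental_system "\<lambda>t. a t + lam" \<phi> \<phi>' \<psi> \<psi>'
  for a :: "real \<Rightarrow> real" and lam :: real and \<phi> \<phi>' \<psi> \<psi>'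
begin

abbreviation hom_solution :: "(real \<Rightarrow> real) \<Rightarrow> (real \<Rightarrow> real) \<Rightarrow> bool" where
  "hom_solution u v \<equiv> ode_solution (\<lambda>t. a t + lam) (\<lambda>_. 0) u v"

lemma X_P_hom_solution_eq_0:
  assumes "nonresonant X_P a lam" and u: "hom_solution u v" and "u 0 = u 1" "v 0 = v 1" and "t \<in> {0..1}"
  shows "u t = 0"
proof -
  have "u \<in> X_P"
    using ode_solution_imp_W21_solves(1)[OF u] assms by (simp add: X_P_def ode_solution_dI[OF u])
  then show ?thesis
    using assms ode_solution_imp_W21_solves(2)[OF u] unfolding nonresonant_def by blast
qed

lemma X_M1_hom_solution_eq_0:
  assumes "nonresonant X_M1 a lam" and u: "hom_solution u v" and "v 0 = 0" "u 1 = 0" and "t \<in> {0..1}"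
  shows "u t = 0"
proof -
  have "u \<in> X_M1"
    using ode_solution_imp_W21_solves(1)[OF u] assms by (simp add: X_M1_def ode_solution_dI[OF u])
  then show ?thesis
    using assms ode_solution_imp_W21_solves(2)[OF u] unfolding nonresonant_def by blast
qed

lemma phi_1_nonzero:
  assumes "nonresonant X_M1 a lam"
  shows "\<phi> 1 \<noteq> 0"
  using X_M1_hom_solution_eq_0[OF assms \<phi>, of 0] \<phi>0 by auto

text \<open>Nonresonance in \<open>X_P\<close> says that no nontrivial combination of \<open>\<phi>\<close> and \<open>\<psi>\<close> has zero jumps
\<open>u(0) - u(1)\<close> and \<open>u'(0) - u'(1)\<close>, so the map from coefficients to jumps is bijective.\<close>

lemma jump_problem_solvable:
  assumes nonres: "nonresonant X_P a lam"
  shows "\<exists>u. u \<in> W21 \<and> solves_ae a lam (\<lambda>_. 0) u \<and> u 0 - u 1 = \<alpha> \<and> dI u 0 - dI u 1 = \<beta>"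
proof -
  have "x = 0 \<and> y = 0"
    if eq: "(\<phi> 0 - \<phi> 1) * x + (\<psi> 0 - \<psi> 1) * y = 0" "(\<phi>' 0 - \<phi>' 1) * x + (\<psi>' 0 - \<psi>' 1) * y = 0" for x y
  proof -
    have u: "hom_solution (\<lambda>t. x * \<phi> t + y * \<psi> t) (\<lambda>t. x * \<phi>' t + y * \<psi>' t)"
      by (rule ode_solution_lincomb_hom[OF \<phi> \<psi>])
    have z: "x * \<phi> t + y * \<psi> t = 0" if "t \<in> {0..1}" for t
      by (rule X_P_hom_solution_eq_0[OF nonres u _ _ that]) (use eq in \<open>simp_all add: algebra_simps\<close>)
    have "x * \<phi>' 0 + y * \<psi>' 0 = dI (\<lambda>t. x * \<phi> t + y * \<psi> t) 0"
      using ode_solution_dI[OF u, of 0] by simp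
    also have "\<dots> = 0"
      by (rule dI_eq) (auto intro!: has_field_derivative_transform_within[OF DERIV_const zero_less_one] simp: z)
    finally show ?thesis using z[of 0] by (simp add: \<phi>0 \<psi>0)
  qed
  then obtain x y where xy: "(\<phi> 0 - \<phi> 1) * x + (\<psi> 0 - \<psi> 1) * y = \<alpha>"
    "(\<phi>' 0 - \<phi>' 1) * x + (\<psi>' 0 - \<psi>' 1) * y = \<beta>"
    by (rule linear_system_2_solvable)
  have u: "hom_solution (\<lambda>t. x * \<phi> t + y * \<psi> t) (\<lambda>t. x * \<phi>' t + y * \<psi>' t)"
    by (rule ode_solution_lincomb_hom[OF \<phi> \<psi>])
  show ?thesis
    using ode_solution_imp_W21_solves[OF u] xy
    by (intro exI[of _ "\<lambda>t. x * \<phi> t + y * \<psi> t"]) (simp add: ode_solution_dI[OF u] algebra_simps)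
qed

lemma r3_solution:
  assumes "nonresonant X_P a lam"
  shows "hom_solution (r3 a lam) (dI (r3 a lam))" and "r3 a lam 0 - r3 a lam 1 = 1"
    and "dI (r3 a lam) 0 - dI (r3 a lam) 1 = 0"
  using someI_ex[OF jump_problem_solvable[OF assms, of 1 0], folded r3_def]
    W21_solves_iff_ode_solution[of "r3 a lam" a lam "\<lambda>_. 0"] by auto

lemma r4_solution:
  assumes "nonresonant X_P a lam"
  shows "hom_solution (r4 a lam) (dI (r4 a lam))" and "r4 a lam 0 - r4 a lam 1 = 0"
    and "dI (r4 a lam) 0 - dI (r4 a lam) 1 = 1"
  using someI_ex[OF jump_problem_solvable[OF assms, of 0 1], folded r4_def]
    W21_solves_iff_ode_solution[of "r4 a lam" a lam "\<lambda>_. 0"] by auto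

text \<open>A homogeneous solution is determined by its jumps, and \<open>r3\<close>, \<open>r4\<close> are the solutions with unit jumps. All
identities between \<open>\<phi>\<close>, \<open>\<psi>\<close>, \<open>r3\<close> and \<open>r4\<close> used below are instances.\<close>

lemma jump_expansion:
  assumes nonres: "nonresonant X_P a lam" and u: "hom_solution u v" and t: "t \<in> {0..1}"
  shows "u t = (u 0 - u 1) * r3 a lam t + (v 0 - v 1) * r4 a lam t"
proof -
  note r3 = r3_solution[OF nonres] and r4 = r4_solution[OF nonres]
  define \<alpha> \<beta> where "\<alpha> = u 0 - u 1" and "\<beta> = v 0 - v 1"
  have w: "hom_solution (\<lambda>t. 1 * u t + (- 1) * (\<alpha> * r3 a lam t + \<beta> * r4 a lam t))
      (\<lambda>t. 1 * v t + (- 1) * (\<alpha> * dI (r3 a lam) t + \<beta> * dI (r4 a lam) t))"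
    by (intro ode_solution_lincomb_hom u r3 r4)
  have eqs: "r3 a lam 0 = 1 + r3 a lam 1" "r4 a lam 0 = r4 a lam 1"
    "dI (r3 a lam) 0 = dI (r3 a lam) 1" "dI (r4 a lam) 0 = 1 + dI (r4 a lam) 1"
    using r3(2,3) r4(2,3) by linarith+
  have "1 * u t + (- 1) * (\<alpha> * r3 a lam t + \<beta> * r4 a lam t) = 0"
    by (rule X_P_hom_solution_eq_0[OF nonres w _ _ t]) (simp_all add: eqs \<alpha>_def \<beta>_def algebra_simps)
  then show ?thesis by (simp add: \<alpha>_def \<beta>_def)
qed

text \<open>The particular solution has zero slope at \<open>0\<close>, and so has \<open>\<phi>\<close>; subtracting \<open>p(1) / \<phi>(1)\<close> times
\<open>\<phi>\<close> corrects the value at \<open>1\<close>.\<close>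

lemma G_M1_eq:
  assumes nonres: "nonresonant X_M1 a lam" and "t \<in> {0..1}" and "s \<in> {0..1}"
  shows "G_M1 a lam t s = green_kernel (\<lambda>t. - \<phi> t / \<phi> 1) (\<lambda>_. 0) t s"
  unfolding G_M1_def
proof (rule green_eq[OF is_green_green_kernel assms(2,3)])
  have "hom_solution (\<lambda>t. (- 1 / \<phi> 1) * \<phi> t + 0 * \<psi> t) (\<lambda>t. (- 1 / \<phi> 1) * \<phi>' t + 0 * \<psi>' t)"
    "hom_solution (\<lambda>t. 0 * \<phi> t + 0 * \<psi> t) (\<lambda>t. 0 * \<phi>' t + 0 * \<psi>' t)"
    by (rule ode_solution_lincomb_hom[OF \<phi> \<psi>])+
  then show "hom_solution (\<lambda>t. - \<phi> t / \<phi> 1) (\<lambda>t. - \<phi>' t / \<phi> 1)" "hom_solution (\<lambda>_. 0) (\<lambda>_. 0)" by simp_all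
  show "(\<lambda>t. u t - w t) \<in> X_M1" if "u \<in> X_M1" "w \<in> X_M1" for u w using that by (rule X_M1_diff)
qed (use phi_1_nonzero[OF nonres] nonres in \<open>auto simp: X_M1_def \<phi>0\<close>)

text \<open>The particular solution has jumps \<open>-p(1)\<close> and \<open>-p'(1)\<close>, which \<open>p(1) r3 + p'(1) r4\<close> cancels.\<close>

lemma G_P_eq:
  assumes nonres: "nonresonant X_P a lam" and "t \<in> {0..1}" and "s \<in> {0..1}"
  shows "G_P a lam t s = green_kernel (r3 a lam) (r4 a lam) t s"
  unfolding G_P_def
proof (rule green_eq[OF is_green_green_kernel assms(2,3)])
  show "hom_solution (r3 a lam) (dI (r3 a lam))" "hom_solution (r4 a lam) (dI (r4 a lam))"
    by (rule r3_solution r4_solution nonres)+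
  show "X_P \<subseteq> W21" by (auto simp: X_P_def)
  show "(\<lambda>t. u t - w t) \<in> X_P" if "u \<in> X_P" "w \<in> X_P" for u w using that by (rule X_P_diff)
  fix u :: "real \<Rightarrow> real" and \<alpha> \<beta> :: real
  assume u: "u \<in> W21" "u 0 = \<alpha> * r3 a lam 0 + \<beta> * r4 a lam 0"
    "dI u 0 = \<alpha> * dI (r3 a lam) 0 + \<beta> * dI (r4 a lam) 0"
    "u 1 = \<alpha> + (\<alpha> * r3 a lam 1 + \<beta> * r4 a lam 1)"
    "dI u 1 = \<beta> + (\<alpha> * dI (r3 a lam) 1 + \<beta> * dI (r4 a lam) 1)"
  have eqs: "r3 a lam 0 = 1 + r3 a lam 1" "r4 a lam 0 = r4 a lam 1"
    "dI (r3 a lam) 0 = dI (r3 a lam) 1" "dI (r4 a lam) 0 = 1 + dI (r4 a lam) 1"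
    using r3_solution(2,3)[OF nonres] r4_solution(2,3)[OF nonres] by linarith+
  show "u \<in> X_P" using u by (simp add: X_P_def eqs algebra_simps)
qed (use nonres in simp_all)

lemma dt_at_1_G_M1:
  assumes nonres: "nonresonant X_M1 a lam" and s: "s \<in> {0..1}"
  shows "dt_at_1 (G_M1 a lam) s = k' 1 s - \<phi>' 1 / \<phi> 1 * k 1 s"
  unfolding dt_at_1_def
proof (rule ext_cont_eq[OF _ _ s])
  show "continuous_on {0..1} (\<lambda>s. k' 1 s - \<phi>' 1 / \<phi> 1 * k 1 s)"
    unfolding k_def k'_def
    by (intro continuous_intros ode_solution_continuous[OF \<phi>] ode_solution_continuous[OF \<psi>])
  fix s :: real assume s: "s \<in> {0<..<1}"
  have "(\<phi> has_real_derivative \<phi>' 1) (at 1 within {0..1})" "(\<psi> has_real_derivative \<psi>' 1) (at 1 within {0..1})"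
    using \<phi> \<psi> by (simp_all add: ode_solution_def)
  then have "((\<lambda>t. k t s + - \<phi> t / \<phi> 1 * k 1 s) has_real_derivative k' 1 s + - \<phi>' 1 / \<phi> 1 * k 1 s) (at 1 within {0..1})"
    unfolding k_def k'_def using phi_1_nonzero[OF nonres] by (auto intro!: derivative_eq_intros)
  then have "((\<lambda>t. G_M1 a lam t s) has_real_derivative k' 1 s + - \<phi>' 1 / \<phi> 1 * k 1 s) (at 1 within {0..1})"
  proof (rule has_field_derivative_transform_within[where d = "1 - s"])
    fix t :: real assume "t \<in> {0..1}" "dist t 1 < 1 - s"
    then show "k t s + - \<phi> t / \<phi> 1 * k 1 s = G_M1 a lam t s"
      using s by (simp add: G_M1_eq[OF nonres] green_kernel_def dist_real_def)
  qed (use s in auto)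
  then show "dI (\<lambda>t. G_M1 a lam t s) 1 = k' 1 s - \<phi>' 1 / \<phi> 1 * k 1 s"
    by (subst dI_eq) auto
qed

text \<open>For \<open>t > 0\<close> the pair \<open>(t, s)\<close> is below the diagonal when \<open>s\<close> is close to \<open>0\<close>, so the kernel can be
differentiated there in closed form. This gives \<open>- \<phi> - \<phi>(1) r3 - \<phi>'(1) r4\<close>, and the jump expansion of
\<open>\<phi>\<close> turns it into \<open>- r3\<close>.\<close>

lemma ds_at_0_G_P:
  assumes nonres: "nonresonant X_P a lam" and t: "t \<in> {0..1}"
  shows "ds_at_0 (G_P a lam) t = - r3 a lam t"
  unfolding ds_at_0_def
proof (rule ext_cont_eq[OF _ _ t])
  show "continuous_on {0..1} (\<lambda>t. - r3 a lam t)"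
    by (intro continuous_intros ode_solution_continuous(1)[OF r3_solution(1)[OF nonres]])
  fix t :: real assume t: "t \<in> {0<..<1}"
  have "(\<phi> has_real_derivative \<phi>' 0) (at 0 within {0..1})" "(\<psi> has_real_derivative \<psi>' 0) (at 0 within {0..1})"
    using \<phi> \<psi> by (simp_all add: ode_solution_def)
  then have "((\<lambda>s. k t s + r3 a lam t * k 1 s + r4 a lam t * k' 1 s) has_real_derivative
      - \<phi> t - r3 a lam t * \<phi> 1 - r4 a lam t * \<phi>' 1) (at 0 within {0..1})"
    unfolding k_def k'_def by (auto intro!: derivative_eq_intros simp: \<phi>0 \<psi>0)
  also have "- \<phi> t - r3 a lam t * \<phi> 1 - r4 a lam t * \<phi>' 1 = - r3 a lam t"
    using jump_expansion[OF nonres \<phi>, of t] t by (simp add: \<phi>0 algebra_simps)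
  finally have "((\<lambda>s. G_P a lam t s) has_real_derivative - r3 a lam t) (at 0 within {0..1})"
  proof (rule has_field_derivative_transform_within[where d = t])
    fix s :: real assume "s \<in> {0..1}" "dist s 0 < t"
    then show "k t s + r3 a lam t * k 1 s + r4 a lam t * k' 1 s = G_P a lam t s"
      using t by (simp add: G_P_eq[OF nonres] green_kernel_def dist_real_def)
  qed (use t in auto)
  then show "dI (\<lambda>s. G_P a lam t s) 0 = - r3 a lam t"
    by (intro dI_eq) auto
qed

lemma G_P_at_0:
  assumes nonres: "nonresonant X_P a lam" and t: "t \<in> {0..1}"
  shows "G_P a lam t 0 = r4 a lam t"
  using G_P_eq[OF nonres t, of 0] jump_expansion[OF nonres \<psi> t] t
  by (simp add: green_kernel_def k_def k'_def \<phi>0 \<psi>0 algebra_simps)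

text \<open>Both kernels contain the same Cauchy term, so the claim concerns only the correction terms. Comparing the
coefficients of \<open>k 1 s\<close> reduces it to the jump expansion of \<open>\<phi>\<close>; the terms with \<open>k' 1 s\<close> cancel.\<close>

lemma G_M1_via_G_P:
  assumes P: "nonresonant X_P a lam" and M1: "nonresonant X_M1 a lam" and t: "t \<in> {0..1}" and s: "s \<in> {0..1}"
  shows "G_M1 a lam t s = G_P a lam t s + r3 a lam t * G_M1 a lam 0 s - r4 a lam t * dt_at_1 (G_M1 a lam) s"
proof -
  note nz = phi_1_nonzero[OF M1]
  have G0: "G_M1 a lam 0 s = - k 1 s / \<phi> 1"
    using G_M1_eq[OF M1 _ s, of 0] s by (cases "s = 0") (simp_all add: green_kernel_def k_def \<phi>0 \<psi>0 diff_divide_distrib)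
  have "\<phi> t = (1 - \<phi> 1) * r3 a lam t - \<phi>' 1 * r4 a lam t"
    using jump_expansion[OF P \<phi> t] by (simp add: \<phi>0)
  then have "- \<phi> t / \<phi> 1 * k 1 s = r3 a lam t * k 1 s + r4 a lam t * k' 1 s
      + r3 a lam t * (- k 1 s / \<phi> 1) - r4 a lam t * (k' 1 s - \<phi>' 1 / \<phi> 1 * k 1 s)"
    using nz by (simp add: divide_simps) (simp add: algebra_simps)
  then show ?thesis
    unfolding G0 dt_at_1_G_M1[OF M1 s] G_M1_eq[OF M1 t s] G_P_eq[OF P t s] green_kernel_def by simp
qed

end

theorem theorem3p36:
  fixes a :: "real \<Rightarrow> real" and lam t s :: real
  assumes "a absolutely_integrable_on {0..1}"
    and "nonresonant X_P a lam"
    and "nonresonant X_M1 a lam"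
    and "t \<in> {0..1}" and "s \<in> {0..1}"
  shows "G_M1 a lam t s =
           G_P a lam t s + r3 a lam t * G_M1 a lam 0 s - r4 a lam t * dt_at_1 (G_M1 a lam) s
       \<and> G_P a lam t s + r3 a lam t * G_M1 a lam 0 s - r4 a lam t * dt_at_1 (G_M1 a lam) s =
           G_P a lam t s - ds_at_0 (G_P a lam) t * G_M1 a lam 0 s
             - G_P a lam t 0 * dt_at_1 (G_M1 a lam) s"
proof -
  have q: "(\<lambda>t. a t + lam) absolutely_integrable_on {0..1}"
    by (intro set_integral_add(1) assms(1) absolutely_integrable_continuous_real continuous_on_const)
  obtain \<phi> \<phi>' where \<phi>: "ode_solution (\<lambda>t. a t + lam) (\<lambda>_. 0) \<phi> \<phi>'" "\<phi> 0 = 1" "\<phi>' 0 = 0"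
    by (rule ode_solution_exists[OF q])
  obtain \<psi> \<psi>' where \<psi>: "ode_solution (\<lambda>t. a t + lam) (\<lambda>_. 0) \<psi> \<psi>'" "\<psi> 0 = 0" "\<psi>' 0 = 1"
    by (rule ode_solution_exists[OF q])
  interpret hill_equation a lam \<phi> \<phi>' \<psi> \<psi>'
    by unfold_locales (fact q \<phi> \<psi>)+
  show ?thesis
    using G_M1_via_G_P[OF assms(2-5)] ds_at_0_G_P[OF assms(2,4)] G_P_at_0[OF assms(2,4)] by simp
qed

end
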